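(* Let $\mu,\mu'$ be probability measures on $\mathbb Z$ whose supports have greatest common divisor $1$ each ($\gcd(S_\mu)=\gcd(S_{\mu'})=1$), let $\xi_1,\xi_1'$ be random variables with laws $\mu,\mu'$, and let $\alpha\in[0,1]$. Suppose that for some $p,q\in\,]0,1[$ with $p+q=1$ at least one of the following holds: (a) $\mathbb E[\xi_1^-]<\mathbb E[\xi_1^+]$, $\mathbb E[(\xi_1^+)^p]<+\infty$, and $\mathbb E[(\xi_1')^+]<\mathbb E[(\xi_1')^-]$, $\mathbb E[((\xi_1')^-)^q]<+\infty$; (b) $\mathbb E[\xi_1^-]=\mathbb E[\xi_1^+]$, $\mathbb E[(\xi_1^+)^{1+p}]<+\infty$, and $\mathbb E[(\xi_1')^+]=\mathbb E[(\xi_1')^-]$, $\mathbb E[((\xi_1')^-)^{1+q}]<+\infty$; (c) $\mathbb E[\xi_1^-]<\mathbb E[\xi_1^+]$, $\mathbb E[(\xi_1^+)^p]<+\infty$, and $\mathbb E[(\xi_1')^+]=\mathbb E[(\xi_1')^-]$, $\mathbb E[((\xi_1')^-)^{1+q}]<+\infty$; (c') $\mathbb E[\xi_1^-]=\mathbb E[\xi_1^+]$, $\mathbb E[(\xi_1^+)^{1+p}]<+\infty$, and $\mathbb E[(\xi_1')^+]<\mathbb E[(\xi_1')^-]$, $\mathbb E[((\xi_1')^-)^{q}]<+\infty$. Then the general oscillating process $\mathcal X^{(\alpha)}(\mu,\mu')$ is recurrent.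
   Context: For a real random variable $Z$, $Z^{\pm}=\max\{\pm Z,0\}$. Expectations of nonnegative variables may be $+\infty$, so a strict inequality such as $\mathbb E[\xi_1^-]<\mathbb E[\xi_1^+]$ means that the left side is finite while the right side is allowed to be $+\infty$. For $\alpha\in[0,1]$, $\mathcal X^{(\alpha)}(\mu,\mu')=(X_n^{(\alpha)})_{n\ge0}$ is the Markov chain on $\mathbb Z$ defined by $$X_{n+1}^{(\alpha)}=X_n^{(\alpha)}+\xi_{n+1}\mathbf 1_{\{X_n^{(\alpha)}\le-1\}}+\eta_{n+1}\mathbf 1_{\{X_n^{(\alpha)}=0\}}+\xi'_{n+1}\mathbf 1_{\{X_n^{(\alpha)}\ge1\}},$$ where $(\xi_n,\xi_n',\eta_n)_{n\ge1}$ is i.i.d., $\xi_n$ has law $\mu$, $\xi_n'$ has law $\mu'$, and $\eta_n$ has law $\alpha\mu+(1-\alpha)\mu'$. Recurrence of $\mathcal X^{(\alpha)}$ means recurrence of the state $0$. *)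

theory Defs
  imports "HOL-Probability.Probability"
begin

definition pos_part :: "real \<Rightarrow> real" where
  "pos_part z = max z 0"

definition neg_part :: "real \<Rightarrow> real" where
  "neg_part z = max (- z) 0"

text \<open>
  Probability measures on the integers are values of type \<^typ>\<open>int pmf\<close>. The triples are i.i.d. in
  the index \<open>n \<ge> 1\<close> (index 0 is unused); nothing is assumed about the joint law of the three
  components of one triple beyond its marginals.
\<close>

locale oscillating_increments = prob_space M
  for M :: "'w measure"
  and \<alpha> :: real
  and \<mu> \<mu>' :: "int pmf"
  and \<xi> \<xi>' \<eta> :: "nat \<Rightarrow> 'w \<Rightarrow> int" +
  assumes indep: "indep_vars (\<lambda>_. count_space UNIV) (\<lambda>n \<omega>. (\<xi> n \<omega>, \<xi>' n \<omega>, \<eta> n \<omega>)) {1..}"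
    and ident: "\<And>n. n \<ge> 1 \<Longrightarrow>
      distr M (count_space UNIV) (\<lambda>\<omega>. (\<xi> n \<omega>, \<xi>' n \<omega>, \<eta> n \<omega>)) =
      distr M (count_space UNIV) (\<lambda>\<omega>. (\<xi> 1 \<omega>, \<xi>' 1 \<omega>, \<eta> 1 \<omega>))"
    and law_\<xi>: "\<And>n. n \<ge> 1 \<Longrightarrow> distr M (count_space UNIV) (\<xi> n) = measure_pmf \<mu>"
    and law_\<xi>': "\<And>n. n \<ge> 1 \<Longrightarrow> distr M (count_space UNIV) (\<xi>' n) = measure_pmf \<mu>'"
    and law_\<eta>: "\<And>n A. n \<ge> 1 \<Longrightarrow>
      measure (distr M (count_space UNIV) (\<eta> n)) A =
      \<alpha> * measure_pmf.prob \<mu> A + (1 - \<alpha>) * measure_pmf.prob \<mu>' A"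

primrec oscillating_process ::
  "(nat \<Rightarrow> 'w \<Rightarrow> int) \<Rightarrow> (nat \<Rightarrow> 'w \<Rightarrow> int) \<Rightarrow> (nat \<Rightarrow> 'w \<Rightarrow> int) \<Rightarrow> int \<Rightarrow> nat \<Rightarrow> 'w \<Rightarrow> int"
where
  "oscillating_process \<xi> \<xi>' \<eta> x 0 \<omega> = x"
| "oscillating_process \<xi> \<xi>' \<eta> x (Suc n) \<omega> =
    (let y = oscillating_process \<xi> \<xi>' \<eta> x n \<omega> in
      y + \<xi> (Suc n) \<omega> * of_bool (y \<le> - 1)
        + \<eta> (Suc n) \<omega> * of_bool (y = 0)
        + \<xi>' (Suc n) \<omega> * of_bool (y \<ge> 1))"

text \<open>
  Here \<open>X x\<close> is the chain started at \<open>x\<close>; a state is recurrent if the chain started there almost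
  surely returns to it at some time \<open>n \<ge> 1\<close>.
\<close>

definition recurrent_state :: "'w measure \<Rightarrow> ('s \<Rightarrow> nat \<Rightarrow> 'w \<Rightarrow> 's) \<Rightarrow> 's \<Rightarrow> bool" where
  "recurrent_state M X s \<longleftrightarrow> (AE \<omega> in M. \<exists>n\<ge>1. X s n \<omega> = s)"

end

theory Submission
  imports Defs
begin

text \<open>
  Let \<open>r x\<close> be the probability that the chain started at \<open>x\<close> never visits \<open>0\<close>. It is harmonic off \<open>0\<close>
  and vanishes at \<open>0\<close>. Optional stopping of each walk at its ladder epochs shows that, for \<open>x < 0\<close>, also
  \<open>r x = E (r (x + H))\<close> with \<open>H\<close> the strict ascending ladder height of \<open>\<mu>\<close>, and, for \<open>x > 0\<close>,
  \<open>r x = E (r (x - T))\<close> with \<open>T\<close> the strict descending ladder height of \<open>\<mu>'\<close>. The ladder chain has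
  the explicit invariant measure with weights \<open>P(T > k)\<close> at \<open>- k\<close> and \<open>P(H > k)\<close> at \<open>k + 1\<close>
  (\<open>k \<ge> 0\<close>). Pairing it, cut off to a window of size \<open>N\<close>, with the identities for \<open>r\<close> bounds
  \<open>E (r H)\<close> by the flux out of the window,
  \<open>P(H > N) E (min T (N + 1)) + P(T > N) E (min H N)\<close>. The moment assumptions give
  \<open>P(H > N) = o(N\<^sup>-\<^sup>p)\<close> and \<open>P(T > N) = o(N\<^sup>-\<^sup>q)\<close>, and since \<open>p + q = 1\<close> the flux tends to \<open>0\<close>. Hence
  \<open>E (r H) = 0\<close>, symmetrically \<open>E (r (- T)) = 0\<close>, and the chain returns to \<open>0\<close> almost surely.
\<close>

section \<open>Expectations of bounded functions\<close>

lemma integrable_pmf_01: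
  fixes f :: "'a \<Rightarrow> real"
  assumes "\<And>x. 0 \<le> f x" and "\<And>x. f x \<le> 1"
  shows "integrable (measure_pmf p) f"
  by (rule measure_pmf.integrable_const_bound[where B=1]) (use assms in auto)

lemma expectation_pmf_01:
  fixes f :: "'a \<Rightarrow> real"
  assumes "\<And>x. 0 \<le> f x" and "\<And>x. f x \<le> 1"
  shows "0 \<le> measure_pmf.expectation p f" and "measure_pmf.expectation p f \<le> 1"
  using assms measure_pmf.integral_le_const[OF integrable_pmf_01[of f p, OF assms], of 1]
  by (auto intro: integral_nonneg_AE)

lemma expectation_bind_pmf_bounded:
  fixes f :: "'b \<Rightarrow> real"
  assumes "\<And>x. 0 \<le> f x" and "\<And>x. f x \<le> B"
  shows "measure_pmf.expectation (bind_pmf M N) f =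
    measure_pmf.expectation M (\<lambda>x. measure_pmf.expectation (N x) f)"
proof -
  have int: "integrable (measure_pmf L) f" for L :: "'b pmf"
    by (rule measure_pmf.integrable_const_bound[where B=B]) (use assms in auto)
  have nn: "0 \<le> measure_pmf.expectation L f" for L :: "'b pmf"
    using assms by (intro integral_nonneg_AE) auto
  have le: "measure_pmf.expectation L f \<le> B" for L :: "'b pmf"
    using assms by (intro measure_pmf.integral_le_const[OF int]) auto
  have int2: "integrable (measure_pmf M) (\<lambda>x. measure_pmf.expectation (N x) f)"
    by (rule measure_pmf.integrable_const_bound[where B=B]) (use nn le in auto)
  \<comment> \<open>The tower rule is free for nonnegative integrals; the bound \<open>B\<close>
    makes every integral finite, so it carries over to the Bochner integral.\<close>
  have "ennreal (measure_pmf.expectation (bind_pmf M N) f) =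
      ennreal (measure_pmf.expectation M (\<lambda>x. measure_pmf.expectation (N x) f))"
    using assms nn
    by (simp add: nn_integral_eq_integral[symmetric] int int2)
  then show ?thesis
    using nn by (simp add: integral_nonneg_AE)
qed

lemma expectation_pair_pmf_prod:
  fixes f :: "'a \<Rightarrow> real" and g :: "'b \<Rightarrow> real"
  assumes f: "\<And>x. 0 \<le> f x" "\<And>x. f x \<le> B" and g: "\<And>x. 0 \<le> g x" "\<And>x. g x \<le> C"
  shows "measure_pmf.expectation (pair_pmf P Q) (\<lambda>(x, y). f x * g y) =
    measure_pmf.expectation P f * measure_pmf.expectation Q g"
proof -
  have bound: "0 \<le> f x * g y" "f x * g y \<le> B * C" for x y
    using f[of x] g[of y] by (auto intro: mult_mono order_trans)
  have "measure_pmf.expectation (pair_pmf P Q) (\<lambda>(x, y). f x * g y) =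
      measure_pmf.expectation P (\<lambda>x. measure_pmf.expectation Q (\<lambda>y. f x * g y))"
    by (simp add: pair_pmf_def expectation_bind_pmf_bounded[where B="B * C"] bound split_beta)
  then show ?thesis by simp
qed

section \<open>The walk stopped on entering the positive integers\<close>

text \<open>Positive states are frozen, so \<open>n\<close> steps from \<open>0\<close> give the law
  of the walk at the smaller of \<open>n\<close> and its first strict ascending ladder epoch. State
  \<open>0\<close> keeps moving because the ladder is strict.\<close>

definition exit_step :: "int pmf \<Rightarrow> int \<Rightarrow> int pmf" where
  "exit_step \<mu> x = (if 0 < x then return_pmf x else map_pmf ((+) x) \<mu>)"

primrec stopped_walk :: "int pmf \<Rightarrow> nat \<Rightarrow> int pmf" where
  "stopped_walk \<mu> 0 = return_pmf 0"
| "stopped_walk \<mu> (Suc n) = bind_pmf (stopped_walk \<mu> n) (exit_step \<mu>)"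

lemma expectation_exit_step:
  fixes f :: "int \<Rightarrow> real"
  shows "measure_pmf.expectation (exit_step \<mu> x) f =
    (if 0 < x then f x else measure_pmf.expectation \<mu> (\<lambda>z. f (x + z)))"
  by (simp add: exit_step_def)

text \<open>Mass above \<open>N \<ge> 0\<close> is frozen there, and new mass arrives only by a jump
  from some \<open>x \<le> 0\<close> exceeding \<open>N - x\<close>; the increments are summed over
  the jump time \<open>j\<close>.\<close>

lemma emeasure_stopped_walk_tail:
  "emeasure (stopped_walk \<mu> n) {int N<..} =
    (\<Sum>j<n. \<integral>\<^sup>+x. indicator {..0} x * emeasure \<mu> {int N - x<..} \<partial>stopped_walk \<mu> j)"
proof (induction n)
  case 0
  show ?case by simp
next
  case (Suc n)
  have step: "emeasure (exit_step \<mu> x) {int N<..} =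
      indicator {int N<..} x + indicator {..0} x * emeasure \<mu> {int N - x<..}" for x
  proof -
    have "(+) x -` {int N<..} = {int N - x<..}" by auto
    then show ?thesis by (auto simp: exit_step_def indicator_def)
  qed
  show ?case
    by (simp add: step nn_integral_add Suc)
qed

text \<open>A large enough constant multiple of counting measure on the nonpositive integers is
  superharmonic for the killed walk, and so dominates its Green function.\<close>

lemma green_function_le:
  fixes \<mu> :: "int pmf"
  defines "C \<equiv> 1 / measure_pmf.prob \<mu> {..<0}"
  assumes neg: "0 < measure_pmf.prob \<mu> {..<0}" and "x \<le> 0"
  shows "(\<Sum>j<n. ennreal (pmf (stopped_walk \<mu> j) x)) \<le> ennreal C"
  using \<open>x \<le> 0\<close>
proof (induction n arbitrary: x)
  case 0
  show ?case by simp
next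
  case (Suc n)
  have C: "0 < C" and C_eq: "C * measure_pmf.prob \<mu> {..<0} = 1"
    using neg by (auto simp: C_def)
  have pmf_step: "ennreal (pmf (exit_step \<mu> y) x) = indicator {..0} y * ennreal (pmf \<mu> (x - y))" for y
  proof (cases "0 < y")
    case True
    then show ?thesis using Suc.prems by (simp add: exit_step_def)
  next
    case False
    have "pmf (map_pmf ((+) y) \<mu>) x = pmf \<mu> (x - y)"
      using pmf_map_inj'[of "(+) y" \<mu> "x - y"] by simp
    then show ?thesis using False by (simp add: exit_step_def)
  qed
  have "(\<Sum>j<n. ennreal (pmf (stopped_walk \<mu> (Suc j)) x)) =
      (\<Sum>j<n. \<integral>\<^sup>+y. ennreal (pmf (stopped_walk \<mu> j) y) *
        (indicator {..0} y * ennreal (pmf \<mu> (x - y))) \<partial>count_space UNIV)"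
    by (simp add: ennreal_pmf_bind pmf_step nn_integral_measure_pmf)
  also have "\<dots> = (\<integral>\<^sup>+y. (\<Sum>j<n. ennreal (pmf (stopped_walk \<mu> j) y)) *
        (indicator {..0} y * ennreal (pmf \<mu> (x - y))) \<partial>count_space UNIV)"
    unfolding sum_distrib_right by (subst nn_integral_sum) simp_all
  also have "\<dots> \<le> (\<integral>\<^sup>+y. ennreal C * (indicator {..0} y * ennreal (pmf \<mu> (x - y)))
      \<partial>count_space UNIV)"
    using Suc.IH by (intro nn_integral_mono) (auto simp: indicator_def intro!: mult_right_mono)
  also have "\<dots> = ennreal C * (\<integral>\<^sup>+y. ennreal (pmf \<mu> (x - y)) \<partial>count_space {..0})"
    by (simp add: nn_integral_cmult nn_integral_count_space_indicator mult.commute)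
  also have "(\<integral>\<^sup>+y. ennreal (pmf \<mu> (x - y)) \<partial>count_space {..0}) = emeasure \<mu> ((\<lambda>y. x - y) ` {..0})"
    by (rule nn_integral_pmf') (auto simp: inj_on_def)
  also have "(\<lambda>y. x - y) ` {..0} = {x..}"
    by (auto intro!: image_eqI[where x="x - y" for y])
  finally have le: "(\<Sum>j<n. ennreal (pmf (stopped_walk \<mu> (Suc j)) x)) \<le>
      ennreal (C * measure_pmf.prob \<mu> {x..})"
    using C by (simp add: measure_pmf.emeasure_eq_measure ennreal_mult)
  have compl: "measure_pmf.prob \<mu> {0..} = 1 - measure_pmf.prob \<mu> {..<0}"
    using measure_pmf.prob_compl[of "{..<0}" \<mu>] by (simp add: Compl_eq_Diff_UNIV[symmetric])
  have "(\<Sum>j<Suc n. ennreal (pmf (stopped_walk \<mu> j) x)) \<le>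
      indicator {0} x + ennreal (C * measure_pmf.prob \<mu> {x..})"
    unfolding sum.lessThan_Suc_shift using le by (intro add_mono) (auto simp: indicator_def)
  \<comment> \<open>At \<open>x = 0\<close> the starting mass \<open>1\<close> is added, and
    equality holds exactly for this choice of \<open>C\<close>; at \<open>x < 0\<close> there is no
    starting mass and the bound is immediate.\<close>
  also have "\<dots> \<le> ennreal C"
  proof (cases "x = 0")
    case True
    have "1 + C * measure_pmf.prob \<mu> {0..} = C"
      unfolding compl using C_eq by (simp add: right_diff_distrib)
    then show ?thesis using True C
      by (simp flip: ennreal_plus ennreal_1)
  next
    case False
    have "C * measure_pmf.prob \<mu> {x..} \<le> C * 1"
      using C by (intro mult_left_mono) auto
    then show ?thesis using False by (simp add: ennreal_leI)
  qed
  finally show ?case .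
qed

text \<open>The sum is the mean of the exit time truncated at \<open>n\<close>. It is bounded by a
  Lyapunov argument: a nonnegative function loses a fixed mean amount at each step taken from the
  nonpositive integers.\<close>

lemma expected_exit_time_le:
  fixes \<mu> :: "int pmf"
  assumes drift: "(\<integral>\<^sup>+z. neg_part (real_of_int z) \<partial>\<mu>) < (\<integral>\<^sup>+z. pos_part (real_of_int z) \<partial>\<mu>)"
  obtains C where "0 \<le> C" and "\<And>n. (\<Sum>j<n. measure_pmf.prob (stopped_walk \<mu> j) {..0}) \<le> C"
proof -
  \<comment> \<open>The mean of the positive part may be infinite; truncating upward steps at a
    large \<open>K\<close> keeps the drift strictly positive and makes both means finite.\<close>
  have "(\<integral>\<^sup>+z. pos_part (real_of_int z) \<partial>\<mu>) =
      (\<integral>\<^sup>+z. (SUP K. ennreal (min (pos_part (real_of_int z)) (real K))) \<partial>\<mu>)"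
  proof (intro nn_integral_cong antisym SUP_least)
    fix z :: int
    obtain K where "pos_part (real_of_int z) \<le> real K"
      using real_arch_simple by blast
    then show "ennreal (pos_part (real_of_int z)) \<le> (SUP K. ennreal (min (pos_part (real_of_int z)) (real K)))"
      by (intro SUP_upper2[of K]) auto
  qed (auto intro: ennreal_leI)
  also have "\<dots> = (SUP K. \<integral>\<^sup>+z. ennreal (min (pos_part (real_of_int z)) (real K)) \<partial>\<mu>)"
    by (intro nn_integral_monotone_convergence_SUP)
      (auto simp: incseq_def le_fun_def intro!: ennreal_leI)
  finally obtain K :: nat where
    K: "(\<integral>\<^sup>+z. neg_part (real_of_int z) \<partial>\<mu>) < (\<integral>\<^sup>+z. min (pos_part (real_of_int z)) (real K) \<partial>\<mu>)"
    using drift by (auto simp: less_SUP_iff)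
  define a where "a = (\<integral>\<^sup>+z. neg_part (real_of_int z) \<partial>\<mu>)"
  define b where "b = (\<integral>\<^sup>+z. min (pos_part (real_of_int z)) (real K) \<partial>\<mu>)"
  have "b \<le> (\<integral>\<^sup>+z. ennreal (real K) \<partial>\<mu>)"
    unfolding b_def by (intro nn_integral_mono ennreal_leI) auto
  then have "b < \<infinity>" by (simp add: le_less_trans[OF _ ennreal_less_top])
  moreover have "a < b" using K by (simp add: a_def b_def)
  ultimately obtain a' b' where ab: "a = ennreal a'" "b = ennreal b'" "0 \<le> a'" "a' < b'"
    by (cases a; cases b) (auto simp: ennreal_less_iff)
  \<comment> \<open>The offset \<open>K\<close> ensures that a jump from \<open>x \<le> 0\<close>
    lowers \<open>\<psi>\<close> by at least the truncated upward step, although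
    \<open>\<psi>\<close> is cut off at \<open>0\<close>.\<close>
  define \<psi> where "\<psi> x = ennreal (max (real K - real_of_int x) 0)" for x
  \<comment> \<open>Gains and losses stand on opposite sides because subtraction in
    \<open>ennreal\<close> truncates at \<open>0\<close>.\<close>
  have drift_step: "(\<integral>\<^sup>+y. \<psi> y \<partial>exit_step \<mu> x) + b * indicator {..0} x \<le> \<psi> x + a * indicator {..0} x" for x
  proof (cases "0 < x")
    case True
    then show ?thesis by (simp add: exit_step_def)
  next
    case False
    have "(\<integral>\<^sup>+z. \<psi> (x + z) \<partial>\<mu>) + b = (\<integral>\<^sup>+z. \<psi> (x + z) + min (pos_part (real_of_int z)) (real K) \<partial>\<mu>)"
      unfolding b_def by (subst nn_integral_add) auto
    also have "\<dots> \<le> (\<integral>\<^sup>+z. \<psi> x + neg_part (real_of_int z) \<partial>\<mu>)"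
    proof (intro nn_integral_mono)
      fix z
      have "max (real K - real_of_int (x + z)) 0 + min (pos_part (real_of_int z)) (real K) \<le>
          max (real K - real_of_int x) 0 + neg_part (real_of_int z)"
        using False by (auto simp: pos_part_def neg_part_def)
      from ennreal_leI[OF this]
      show "\<psi> (x + z) + min (pos_part (real_of_int z)) (real K) \<le> \<psi> x + neg_part (real_of_int z)"
        unfolding \<psi>_def by (simp add: pos_part_def neg_part_def)
    qed
    also have "\<dots> = \<psi> x + a"
      unfolding a_def by (subst nn_integral_add) auto
    finally show ?thesis using False by (simp add: exit_step_def)
  qed
  define S where "S n = (\<Sum>j<n. measure_pmf.prob (stopped_walk \<mu> j) {..0})" for n
  have S_nonneg: "0 \<le> S n" for n by (simp add: S_def sum_nonneg)
  have "(\<integral>\<^sup>+x. \<psi> x \<partial>stopped_walk \<mu> n) + b * ennreal (S n) \<le> ennreal (real K) + a * ennreal (S n)" for n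
  proof (induction n)
    case 0
    show ?case by (simp add: \<psi>_def S_def)
  next
    case (Suc n)
    let ?P = "emeasure (stopped_walk \<mu> n) {..0}"
    have S_Suc: "ennreal (S (Suc n)) = ennreal (S n) + ?P"
      using S_nonneg[of n] by (simp add: S_def measure_pmf.emeasure_eq_measure)
    have "(\<integral>\<^sup>+x. \<psi> x \<partial>stopped_walk \<mu> (Suc n)) + b * ?P =
        (\<integral>\<^sup>+x. (\<integral>\<^sup>+y. \<psi> y \<partial>exit_step \<mu> x) + b * indicator {..0} x \<partial>stopped_walk \<mu> n)"
      by (subst nn_integral_add) (simp_all add: nn_integral_cmult)
    also have "\<dots> \<le> (\<integral>\<^sup>+x. \<psi> x + a * indicator {..0} x \<partial>stopped_walk \<mu> n)"
      by (intro nn_integral_mono drift_step)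
    also have "\<dots> = (\<integral>\<^sup>+x. \<psi> x \<partial>stopped_walk \<mu> n) + a * ?P"
      by (subst nn_integral_add) (simp_all add: nn_integral_cmult)
    finally have "(\<integral>\<^sup>+x. \<psi> x \<partial>stopped_walk \<mu> (Suc n)) + b * ?P + b * ennreal (S n) \<le>
        (\<integral>\<^sup>+x. \<psi> x \<partial>stopped_walk \<mu> n) + a * ?P + b * ennreal (S n)"
      by (rule add_right_mono)
    also have "\<dots> \<le> ennreal (real K) + a * ennreal (S n) + a * ?P"
      using add_right_mono[OF Suc, of "a * ?P"] by (simp add: ac_simps)
    finally show ?case
      unfolding S_Suc by (simp add: distrib_left ac_simps)
  qed
  then have "b * ennreal (S n) \<le> ennreal (real K) + a * ennreal (S n)" for n
    by (meson add_increasing order_refl order_trans zero_le)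
  from this[unfolded ab] have "b' * S n \<le> real K + a' * S n" for n
    using ab S_nonneg[of n] ennreal_le_iff[of "real K + a' * S n" "b' * S n"]
    by (simp add: ennreal_mult)
  then have "S n \<le> real K / (b' - a')" for n
    using ab by (simp add: field_simps)
  then show thesis
    using that[of "real K / (b' - a')"] ab by (simp add: S_def)
qed

lemma integral_tail_tendsto_0:
  fixes f :: "int \<Rightarrow> real"
  assumes "integrable (measure_pmf \<mu>) f"
  shows "(\<lambda>N. \<integral>z. f z * indicator {int N<..} z \<partial>\<mu>) \<longlonglongrightarrow> 0"
proof -
  have "(\<lambda>N. \<integral>z. f z * indicator {int N<..} z \<partial>\<mu>) \<longlonglongrightarrow> (\<integral>z. 0 \<partial>\<mu>)"
  proof (rule integral_dominated_convergence[where w="\<lambda>z. \<bar>f z\<bar>"])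
    show "AE z in \<mu>. (\<lambda>N. f z * indicator {int N<..} z) \<longlonglongrightarrow> 0"
    proof (rule AE_I2)
      fix z
      have "eventually (\<lambda>N. f z * indicator {int N<..} z = 0) sequentially"
        using eventually_ge_at_top[of "nat z"] by eventually_elim auto
      then show "(\<lambda>N. f z * indicator {int N<..} z) \<longlonglongrightarrow> 0"
        by (rule tendsto_eventually)
    qed
  qed (use assms in \<open>auto simp: indicator_def\<close>)
  then show ?thesis by simp
qed

text \<open>The bound \<open>b N\<close> is uniform in \<open>n\<close>, so it also controls the tail of the ladder height, the
  limit law of the stopped walk.\<close>

lemma uniform_tail_bound:
  fixes \<mu> :: "int pmf" and f :: "int \<Rightarrow> real"
  assumes f: "\<And>z. 0 \<le> f z" "(\<integral>\<^sup>+z. f z \<partial>\<mu>) < \<infinity>" and "0 \<le> C"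
    and tail: "\<And>n N. 0 < N \<Longrightarrow> ennreal (real N powr p) * emeasure (stopped_walk \<mu> n) {int N<..} \<le>
      ennreal C * (\<integral>\<^sup>+z. ennreal (f z * indicator {int N<..} z) \<partial>\<mu>)"
  obtains b where "\<And>n N. measure_pmf.prob (stopped_walk \<mu> n) {int N<..} \<le> b N"
    and "(\<lambda>N. real N powr p * b N) \<longlonglongrightarrow> 0"
proof
  have int: "integrable (measure_pmf \<mu>) f"
    using f by (intro integrableI_nonneg) auto
  define t where "t N = (\<integral>z. f z * indicator {int N<..} z \<partial>\<mu>)" for N
  have int_t: "integrable (measure_pmf \<mu>) (\<lambda>z. f z * indicator {int N<..} z)" for N
    by (rule Bochner_Integration.integrable_bound[OF int]) (auto simp: indicator_def)
  have t_nonneg: "0 \<le> t N" for N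
    using f by (simp add: t_def)
  \<comment> \<open>At \<open>N = 0\<close> the quotient would be \<open>0\<close>, since
    \<open>0 powr p = 0\<close>, so the trivial bound \<open>1\<close> replaces it.\<close>
  let ?b = "\<lambda>N. if N = 0 then 1 else C * t N / real N powr p"
  show "measure_pmf.prob (stopped_walk \<mu> n) {int N<..} \<le> ?b N" for n N
  proof (cases "N = 0")
    case False
    have "(\<integral>\<^sup>+z. ennreal (f z * indicator {int N<..} z) \<partial>\<mu>) = ennreal (t N)"
      unfolding t_def using f by (intro nn_integral_eq_integral int_t) auto
    then have "real N powr p * measure_pmf.prob (stopped_walk \<mu> n) {int N<..} \<le> C * t N"
      using tail[of N n] False \<open>0 \<le> C\<close> t_nonneg[of N]
      by (simp add: measure_pmf.emeasure_eq_measure flip: ennreal_mult)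
    then show ?thesis using False by (simp add: field_simps)
  qed simp
  have "(\<lambda>N. C * t N) \<longlonglongrightarrow> C * 0"
    unfolding t_def by (intro tendsto_mult tendsto_const integral_tail_tendsto_0 int)
  moreover have "eventually (\<lambda>N. C * t N = real N powr p * ?b N) sequentially"
    using eventually_gt_at_top[of 0] by eventually_elim auto
  ultimately show "(\<lambda>N. real N powr p * ?b N) \<longlonglongrightarrow> 0"
    by (simp add: tendsto_cong)
qed

text \<open>The exit jump starts from some \<open>x \<le> 0\<close>, so it must exceed
  \<open>N\<close>. The tail is thus at most the bounded mean number of steps times the tail of
  \<open>\<mu>\<close>, to which Markov's inequality restricted to \<open>{N<..}\<close>
  applies.\<close>

lemma stopped_walk_tail_drift:
  fixes \<mu> :: "int pmf"
  assumes drift: "(\<integral>\<^sup>+z. neg_part (real_of_int z) \<partial>\<mu>) < (\<integral>\<^sup>+z. pos_part (real_of_int z) \<partial>\<mu>)"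
    and moment: "(\<integral>\<^sup>+z. pos_part (real_of_int z) powr p \<partial>\<mu>) < \<infinity>" and "0 < p"
  obtains b where "\<And>n N. measure_pmf.prob (stopped_walk \<mu> n) {int N<..} \<le> b N"
    and "(\<lambda>N. real N powr p * b N) \<longlonglongrightarrow> 0"
proof -
  obtain C where C: "0 \<le> C" "\<And>n. (\<Sum>j<n. measure_pmf.prob (stopped_walk \<mu> j) {..0}) \<le> C"
    using expected_exit_time_le[OF drift] by blast
  have "ennreal (real N powr p) * emeasure (stopped_walk \<mu> n) {int N<..} \<le>
      ennreal C * (\<integral>\<^sup>+z. ennreal (pos_part (real_of_int z) powr p * indicator {int N<..} z) \<partial>\<mu>)" for n N
  proof -
    have "emeasure (stopped_walk \<mu> n) {int N<..} \<le>
        (\<Sum>j<n. \<integral>\<^sup>+x. indicator {..0} x * emeasure \<mu> {int N<..} \<partial>stopped_walk \<mu> j)"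
      unfolding emeasure_stopped_walk_tail
      by (intro sum_mono nn_integral_mono) (auto simp: indicator_def intro!: emeasure_mono)
    also have "\<dots> = (\<Sum>j<n. emeasure (stopped_walk \<mu> j) {..0}) * emeasure \<mu> {int N<..}"
      by (simp add: nn_integral_multc sum_distrib_right)
    also have "\<dots> \<le> ennreal C * emeasure \<mu> {int N<..}"
      using C(2)[of n]
      by (intro mult_right_mono) (auto simp: measure_pmf.emeasure_eq_measure intro!: ennreal_leI)
    finally have "ennreal (real N powr p) * emeasure (stopped_walk \<mu> n) {int N<..} \<le>
        ennreal C * (ennreal (real N powr p) * emeasure \<mu> {int N<..})"
      by (metis mult.left_commute mult_left_mono zero_le)
    also have "ennreal (real N powr p) * emeasure \<mu> {int N<..} =
        (\<integral>\<^sup>+z. ennreal (real N powr p) * indicator {int N<..} z \<partial>\<mu>)"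
      by (simp add: nn_integral_cmult)
    also have "\<dots> \<le> (\<integral>\<^sup>+z. ennreal (pos_part (real_of_int z) powr p * indicator {int N<..} z) \<partial>\<mu>)"
      using \<open>0 < p\<close>
      by (intro nn_integral_mono) (auto simp: indicator_def pos_part_def intro!: ennreal_leI powr_mono2)
    finally show ?thesis by (simp add: mult_left_mono)
  qed
  then show thesis
    using uniform_tail_bound[OF _ moment C(1), of p] that by auto
qed

text \<open>Instead of the mean exit time, the Green function is used: it is at most
  \<open>C\<close> at every \<open>x \<le> 0\<close>. Summing the jump tails over these
  \<open>x\<close> gives the mean excess of a step over \<open>N\<close>, which costs one more
  moment.\<close>

lemma stopped_walk_tail_centered:
  fixes \<mu> :: "int pmf"
  assumes neg: "0 < measure_pmf.prob \<mu> {..<0}"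
    and moment: "(\<integral>\<^sup>+z. pos_part (real_of_int z) powr (1 + p) \<partial>\<mu>) < \<infinity>" and "0 < p"
  obtains b where "\<And>n N. measure_pmf.prob (stopped_walk \<mu> n) {int N<..} \<le> b N"
    and "(\<lambda>N. real N powr p * b N) \<longlonglongrightarrow> 0"
proof -
  define C where "C = 1 / measure_pmf.prob \<mu> {..<0}"
  have C: "0 \<le> C" using neg by (simp add: C_def)
  interpret pair_sigma_finite "count_space (UNIV :: int set)" "measure_pmf \<mu>"
    by (intro pair_sigma_finite.intro sigma_finite_measure_count_space measure_pmf.sigma_finite_measure_axioms)
  \<comment> \<open>Fubini needs joint measurability, which is automatic here because every subset
    of the countable product is measurable.\<close>
  have sets_eq: "sets (count_space (UNIV :: int set) \<Otimes>\<^sub>M measure_pmf \<mu>) = UNIV"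
  proof -
    have "sets (count_space (UNIV :: int set) \<Otimes>\<^sub>M measure_pmf \<mu>) =
        sets (count_space (UNIV :: int set) \<Otimes>\<^sub>M count_space (UNIV :: int set))"
      by (intro sets_pair_measure_cong) auto
    then show ?thesis unfolding pair_measure_countable[OF countableI_type countableI_type] by simp
  qed
  have "ennreal (real N powr p) * emeasure (stopped_walk \<mu> n) {int N<..} \<le>
      ennreal C * (\<integral>\<^sup>+z. ennreal (pos_part (real_of_int z) powr (1 + p) * indicator {int N<..} z) \<partial>\<mu>)" for n N
  proof -
    have "emeasure (stopped_walk \<mu> n) {int N<..} =
        (\<integral>\<^sup>+x. (\<Sum>j<n. ennreal (pmf (stopped_walk \<mu> j) x)) *
          (indicator {..0} x * emeasure \<mu> {int N - x<..}) \<partial>count_space UNIV)"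
      unfolding emeasure_stopped_walk_tail nn_integral_measure_pmf[of "stopped_walk \<mu> _"] sum_distrib_right
      by (subst nn_integral_sum) simp_all
    also have "\<dots> \<le> (\<integral>\<^sup>+x. ennreal C * (indicator {..0} x * emeasure \<mu> {int N - x<..}) \<partial>count_space UNIV)"
      using green_function_le[OF neg]
      by (intro nn_integral_mono) (auto simp: indicator_def C_def intro!: mult_right_mono)
    also have "\<dots> = ennreal C * (\<integral>\<^sup>+x. \<integral>\<^sup>+z. indicator {..0} x * indicator {int N - x<..} z \<partial>\<mu> \<partial>count_space UNIV)"
      by (simp add: nn_integral_cmult)
    also have "(\<integral>\<^sup>+x. \<integral>\<^sup>+z. indicator {..0} x * indicator {int N - x<..} z \<partial>\<mu> \<partial>count_space UNIV) =
        (\<integral>\<^sup>+z. \<integral>\<^sup>+x. indicator {..0} x * indicator {int N - x<..} z \<partial>count_space UNIV \<partial>\<mu>)"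
      by (rule Fubini'[symmetric]) (simp add: measurable_def sets_eq)
    \<comment> \<open>For fixed \<open>z > N\<close> the admissible starting points are the
      \<open>z - N\<close> integers in \<open>{N - z<..0}\<close>; for \<open>z \<le> N\<close>
      there are none.\<close>
    also have "\<dots> = (\<integral>\<^sup>+z. \<integral>\<^sup>+x. indicator {int N - z<..0} x \<partial>count_space UNIV \<partial>\<mu>)"
      by (intro nn_integral_cong) (auto simp: indicator_def)
    also have "\<dots> = (\<integral>\<^sup>+z. ennreal (real (nat (z - int N))) \<partial>\<mu>)"
      by (intro nn_integral_cong) (simp add: ennreal_of_nat_eq_real_of_nat)
    finally have "ennreal (real N powr p) * emeasure (stopped_walk \<mu> n) {int N<..} \<le>
        ennreal (real N powr p) * (ennreal C * (\<integral>\<^sup>+z. ennreal (real (nat (z - int N))) \<partial>\<mu>))"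
      by (intro mult_left_mono) auto
    also have "\<dots> = ennreal C * (\<integral>\<^sup>+z. ennreal (real N powr p) * ennreal (real (nat (z - int N))) \<partial>\<mu>)"
      by (simp add: nn_integral_cmult ac_simps)
    also have "(\<integral>\<^sup>+z. ennreal (real N powr p) * ennreal (real (nat (z - int N))) \<partial>\<mu>) \<le>
        (\<integral>\<^sup>+z. ennreal (pos_part (real_of_int z) powr (1 + p) * indicator {int N<..} z) \<partial>\<mu>)"
    proof (intro nn_integral_mono)
      fix z
      have "real N powr p * real (nat (z - int N)) \<le> pos_part (real_of_int z) powr (1 + p)" if "int N < z"
      proof -
        have "real N powr p * real (nat (z - int N)) \<le> real_of_int z powr p * real_of_int z"
          using that \<open>0 < p\<close> by (intro mult_mono powr_mono2) auto
        then show ?thesis using that by (simp add: pos_part_def powr_add mult.commute)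
      qed
      then show "ennreal (real N powr p) * ennreal (real (nat (z - int N))) \<le>
          ennreal (pos_part (real_of_int z) powr (1 + p) * indicator {int N<..} z)"
        by (auto simp: indicator_def simp flip: ennreal_mult intro!: ennreal_leI)
    qed
    finally show ?thesis by (simp add: mult_left_mono)
  qed
  then show thesis
    using uniform_tail_bound[OF _ moment C, of p] that by auto
qed

section \<open>Almost sure finiteness of the exit time\<close>

lemma exit_time_finite_drift:
  fixes \<mu> :: "int pmf"
  assumes "(\<integral>\<^sup>+z. neg_part (real_of_int z) \<partial>\<mu>) < (\<integral>\<^sup>+z. pos_part (real_of_int z) \<partial>\<mu>)"
  shows "(\<lambda>n. measure_pmf.prob (stopped_walk \<mu> n) {..0}) \<longlonglongrightarrow> 0"
proof -
  obtain C where "\<And>n. (\<Sum>j<n. measure_pmf.prob (stopped_walk \<mu> j) {..0}) \<le> C"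
    using expected_exit_time_le[OF assms] by blast
  then show ?thesis
    by (intro summable_LIMSEQ_zero summableI_nonneg_bounded[where x=C]) auto
qed

text \<open>Probability that the walk from \<open>x\<close> is nonpositive at all times
  \<open>0\<close> to \<open>n\<close>. It unfolds at the first step, so that its limit in
  \<open>n\<close> is harmonic in \<open>x\<close>, whereas \<open>stopped_walk\<close> unfolds at
  the last step.\<close>

primrec survival :: "int pmf \<Rightarrow> nat \<Rightarrow> int \<Rightarrow> real" where
  "survival \<mu> 0 x = of_bool (x \<le> 0)"
| "survival \<mu> (Suc n) x = of_bool (x \<le> 0) * measure_pmf.expectation \<mu> (\<lambda>z. survival \<mu> n (x + z))"

lemma survival_01: "0 \<le> survival \<mu> n x" "survival \<mu> n x \<le> 1"
proof -
  have "0 \<le> survival \<mu> n x \<and> survival \<mu> n x \<le> 1"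
  proof (induction n arbitrary: x)
    case (Suc n)
    then show ?case using expectation_pmf_01[of "\<lambda>z. survival \<mu> n (x + z)" \<mu>] by auto
  qed auto
  then show "0 \<le> survival \<mu> n x" "survival \<mu> n x \<le> 1" by auto
qed

lemma survival_pos: "0 < x \<Longrightarrow> survival \<mu> n x = 0"
  by (cases n) auto

lemma survival_antimono: "x \<le> y \<Longrightarrow> survival \<mu> n y \<le> survival \<mu> n x"
proof (induction n arbitrary: x y)
  case (Suc n)
  have "measure_pmf.expectation \<mu> (\<lambda>z. survival \<mu> n (y + z)) \<le>
      measure_pmf.expectation \<mu> (\<lambda>z. survival \<mu> n (x + z))"
    using Suc by (intro integral_mono integrable_pmf_01) (auto simp: survival_01)
  then show ?case
    using Suc.prems expectation_pmf_01[of "\<lambda>z. survival \<mu> n (x + z)" \<mu>] by (auto simp: survival_01)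
qed auto

lemma survival_decseq: "decseq (\<lambda>n. survival \<mu> n x)"
proof (rule decseq_SucI)
  show "survival \<mu> (Suc n) x \<le> survival \<mu> n x" for n
  proof (induction n arbitrary: x)
    case 0
    show ?case using expectation_pmf_01[of "\<lambda>z. survival \<mu> 0 (x + z)" \<mu>] by auto
  next
    case (Suc n)
    have "measure_pmf.expectation \<mu> (\<lambda>z. survival \<mu> (Suc n) (x + z)) \<le>
        measure_pmf.expectation \<mu> (\<lambda>z. survival \<mu> n (x + z))"
      by (intro integral_mono integrable_pmf_01 Suc) (auto simp only: survival_01)
    then show ?case
      by (subst (1 2) survival.simps) (auto simp del: survival.simps)
  qed
qed

lemma prob_stopped_walk_eq_survival:
  "measure_pmf.prob (stopped_walk \<mu> n) {..0} = survival \<mu> n 0"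
proof -
  \<comment> \<open>Moving steps one at a time from the forward law to the backward recursion links
    the two descriptions; \<open>k = 0\<close> gives the claim.\<close>
  have "measure_pmf.expectation (stopped_walk \<mu> m) (survival \<mu> k) = survival \<mu> (m + k) 0" for m k
  proof (induction m arbitrary: k)
    case 0
    show ?case by simp
  next
    case (Suc m)
    have "measure_pmf.expectation (exit_step \<mu> x) (survival \<mu> k) = survival \<mu> (Suc k) x" for x
      by (simp add: expectation_exit_step survival_pos)
    then show ?case
      using Suc[of "Suc k"]
      by (simp add: expectation_bind_pmf_bounded[where B=1] survival_01 del: survival.simps)
  qed
  moreover have "survival \<mu> 0 = indicator {..0}" by (auto simp: indicator_def)
  ultimately show ?thesis
    using Bochner_Integration.integral_indicator[of "measure_pmf (stopped_walk \<mu> n)" "{..0}"]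
    by (simp add: measure_pmf.emeasure_eq_measure flip: \<open>survival \<mu> 0 = _\<close>)
qed

text \<open>The limit \<open>r\<close> of the survival probabilities is harmonic on the nonpositive integers. Summing
  \<open>r (x + z) - r x\<close> over \<open>-N \<le> x \<le> 0\<close> and averaging over \<open>z\<close> gives \<open>0\<close>; as \<open>N\<close> grows, the terms
  near \<open>-N\<close> contribute a multiple of the mean, which vanishes, and only a negative term near \<open>0\<close>
  survives.\<close>

lemma exit_time_finite_centered:
  fixes \<mu> :: "int pmf"
  assumes int: "integrable (measure_pmf \<mu>) real_of_int" and mean: "(\<integral>z. real_of_int z \<partial>\<mu>) = 0"
    and neg: "0 < measure_pmf.prob \<mu> {..<0}"
  shows "(\<lambda>n. measure_pmf.prob (stopped_walk \<mu> n) {..0}) \<longlonglongrightarrow> 0"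
proof -
  have "\<exists>l. (\<lambda>n. survival \<mu> n x) \<longlonglongrightarrow> l" for x
    using decseq_convergent[OF survival_decseq, of 0 \<mu> x] survival_01(1) by metis
  then obtain r where r: "\<And>x. (\<lambda>n. survival \<mu> n x) \<longlonglongrightarrow> r x"
    by metis
  have r_01: "0 \<le> r x" "r x \<le> 1" for x
    using r[of x] by (auto intro: LIMSEQ_le_const LIMSEQ_le_const2 simp: survival_01)
  have r_pos: "r x = 0" if "0 < x" for x
    using r[of x] that by (simp add: survival_pos LIMSEQ_const_iff)
  have r_antimono: "r y \<le> r x" if "x \<le> y" for x y
    using r[of x] r[of y] that by (intro LIMSEQ_le[OF r r]) (auto simp: survival_antimono)
  have harmonic: "r x = (\<integral>z. r (x + z) \<partial>\<mu>)" if "x \<le> 0" for x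
  proof -
    have "(\<lambda>n. \<integral>z. survival \<mu> n (x + z) \<partial>\<mu>) \<longlonglongrightarrow> (\<integral>z. r (x + z) \<partial>\<mu>)"
      by (rule integral_dominated_convergence[where w="\<lambda>_. 1"]) (auto simp: r survival_01)
    moreover have "(\<lambda>n. \<integral>z. survival \<mu> n (x + z) \<partial>\<mu>) \<longlonglongrightarrow> r x"
      using LIMSEQ_Suc[OF r[of x]] that by simp
    ultimately show ?thesis using LIMSEQ_unique by blast
  qed
  define D where "D N z = (\<Sum>x\<in>{- int N..0}. r (x + z) - r x)" for N z
  have D_mean: "(\<integral>z. D N z \<partial>\<mu>) = 0" for N
    unfolding D_def
    by (subst Bochner_Integration.integral_sum)
      (auto simp: integrable_pmf_01 r_01 simp flip: harmonic)
  \<comment> \<open>Raising \<open>z\<close> by one shifts the window: the term at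
    \<open>z + 1\<close> enters and the one at \<open>z - N\<close> leaves.\<close>
  have D_step: "D N (z + 1) = D N z + (r (z + 1) - r (z - int N))" for N z
  proof (induction N)
    case 0
    show ?case by (simp add: D_def)
  next
    case (Suc N)
    have "{- int (Suc N)..0} = insert (- int (Suc N)) {- int N..0}" by auto
    then have step: "D (Suc N) y = D N y + (r (y - int (Suc N)) - r (- int (Suc N)))" for y
      by (simp add: D_def algebra_simps)
    have "z + 1 - int (Suc N) = z - int N" by simp
    then show ?case unfolding step[of z] step[of "z + 1"] Suc by simp
  qed
  have D_0: "D N 0 = 0" for N by (simp add: D_def)
  \<comment> \<open>Each such exchange changes \<open>D\<close> by at most \<open>1\<close>, which
    yields an integrable dominating function independent of \<open>N\<close>.\<close>
  have D_bound: "\<bar>D N z\<bar> \<le> real_of_int \<bar>z\<bar>" for N z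
  proof (induction z rule: int_induct[where k=0])
    case base
    show ?case by (simp add: D_0)
  next
    case (step1 i)
    then show ?case using r_01[of "i + 1"] r_01[of "i - int N"] unfolding D_step by linarith
  next
    case (step2 i)
    then show ?case
      using r_01[of i] r_01[of "i - 1 - int N"] D_step[of N "i - 1"] by simp
  qed
  have "incseq (\<lambda>N. r (- int N))"
    by (auto simp: incseq_def intro: r_antimono)
  then obtain L where "(\<lambda>N. r (- int N)) \<longlonglongrightarrow> L"
    using incseq_convergent[of "\<lambda>N. r (- int N)" 1] r_01(2) by metis
  then have L: "(\<lambda>N. r (z - int N)) \<longlonglongrightarrow> L" for z
  proof (induction z rule: int_induct[where k=0])
    case base
    then show ?case by simp
  next
    case (step1 i)
    then have "(\<lambda>N. r (i + 1 - int (N + 1))) \<longlonglongrightarrow> L"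
      by simp
    then show ?case by (rule LIMSEQ_offset)
  next
    case (step2 i)
    then have "(\<lambda>N. r (i - int (N + 1))) \<longlonglongrightarrow> L"
      by (intro LIMSEQ_ignore_initial_segment) simp
    then show ?case by (simp add: diff_diff_eq add.commute)
  qed
  \<comment> \<open>For \<open>z > 0\<close> the limit is \<open>- L * z\<close>, since
    \<open>r\<close> vanishes at positive points. For \<open>z < 0\<close> it is
    \<open>- L * z\<close> minus the sum of \<open>r\<close> over \<open>{z + 1..0}\<close>, of
    which only \<open>r 0\<close> is kept.\<close>
  have "\<exists>l. (\<lambda>N. D N z) \<longlonglongrightarrow> l \<and> l \<le> - L * real_of_int z - r 0 * indicator {..<0} z" for z
  proof (induction z rule: int_induct[where k=0])
    case base
    show ?case by (auto simp: D_0)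
  next
    case (step1 i)
    then obtain l where l: "(\<lambda>N. D N i) \<longlonglongrightarrow> l" "l \<le> - L * real_of_int i - r 0 * indicator {..<0} i"
      by blast
    have "(\<lambda>N. D N (i + 1)) \<longlonglongrightarrow> l + (r (i + 1) - L)"
      unfolding D_step by (intro tendsto_intros l L)
    then show ?case using l(2) step1 r_pos[of "i + 1"] by (auto simp: algebra_simps)
  next
    case (step2 i)
    then obtain l where l: "(\<lambda>N. D N i) \<longlonglongrightarrow> l" "l \<le> - L * real_of_int i - r 0 * indicator {..<0} i"
      by blast
    have "(\<lambda>N. D N i - (r i - r (i - 1 - int N))) \<longlonglongrightarrow> l - (r i - L)"
      by (intro tendsto_intros l L)
    then have "(\<lambda>N. D N (i - 1)) \<longlonglongrightarrow> l - (r i - L)"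
      using D_step[of _ "i - 1"] by simp
    moreover have "l - (r i - L) \<le> - L * real_of_int (i - 1) - r 0 * indicator {..<0} (i - 1)"
      using l(2) step2 r_01[of i] by (cases "i = 0") (auto simp: algebra_simps)
    ultimately show ?case by blast
  qed
  then obtain l where l: "\<And>z. (\<lambda>N. D N z) \<longlonglongrightarrow> l z"
    "\<And>z. l z \<le> - L * real_of_int z - r 0 * indicator {..<0} z"
    by metis
  have l_bound: "\<bar>l z\<bar> \<le> real_of_int \<bar>z\<bar>" for z
    by (rule LIMSEQ_le_const2[OF tendsto_rabs[OF l(1)]]) (use D_bound in blast)
  have int_l: "integrable (measure_pmf \<mu>) l"
    by (rule Bochner_Integration.integrable_bound[OF int]) (use l_bound in simp_all)
  have conv: "(\<lambda>N. \<integral>z. D N z \<partial>\<mu>) \<longlonglongrightarrow> (\<integral>z. l z \<partial>\<mu>)"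
    by (rule integral_dominated_convergence[where w="\<lambda>z. \<bar>real_of_int z\<bar>"])
      (use l(1) int D_bound in simp_all)
  have int_parts: "integrable (measure_pmf \<mu>) (\<lambda>z. - L * real_of_int z)"
    "integrable (measure_pmf \<mu>) (\<lambda>z. r 0 * indicator {..<0} z)"
    by (intro integrable_mult_right int integrable_real_indicator;
      simp add: measure_pmf.emeasure_eq_measure)+
  have "0 = (\<integral>z. l z \<partial>\<mu>)"
    using conv by (simp add: D_mean LIMSEQ_const_iff)
  also have "\<dots> \<le> (\<integral>z. - L * real_of_int z - r 0 * indicator {..<0} z \<partial>\<mu>)"
    by (intro integral_mono int_l l(2) Bochner_Integration.integrable_diff int_parts)
  also have "\<dots> = - r 0 * measure_pmf.prob \<mu> {..<0}"
    unfolding Bochner_Integration.integral_diff[OF int_parts] integral_mult_right_zero mean by simp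
  finally have "r 0 = 0"
    using neg r_01[of 0] by (simp add: mult_le_0_iff zero_le_mult_iff)
  then show ?thesis
    using r[of 0] by (simp add: prob_stopped_walk_eq_survival)
qed

section \<open>Partial sums of power-law tails\<close>

lemma sum_powr_le:
  assumes "0 < q" "q < 1"
  shows "(\<Sum>k\<in>{1..n}. real k powr (- q)) \<le> real n powr (1 - q) / (1 - q)"
proof (induction n)
  case (Suc n)
  \<comment> \<open>A discrete comparison with the integral of \<open>x powr (- q)\<close>. Young's
    inequality bounds the weighted geometric mean of \<open>n\<close> and \<open>n + 1\<close> by
    \<open>n + q\<close>; dividing by \<open>(n + 1) powr q\<close> gives the increment.\<close>
  have "(1 - q) * real (Suc n) powr (- q) \<le> real (Suc n) powr (1 - q) - real n powr (1 - q)"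
  proof (cases "n = 0")
    case False
    have "real n powr (1 - q) * real (Suc n) powr q \<le> (1 - q) * real n + q * real (Suc n)"
      using assms False by (intro Youngs_inequality_0) auto
    also have "\<dots> = real (Suc n) powr (1 - q) * real (Suc n) powr q - (1 - q)"
      by (simp add: algebra_simps flip: powr_add)
    finally have "(1 - q) \<le> (real (Suc n) powr (1 - q) - real n powr (1 - q)) * real (Suc n) powr q"
      by (simp add: algebra_simps)
    then show ?thesis by (simp add: powr_minus field_simps)
  qed (use assms in simp)
  then have "real (Suc n) powr (- q) \<le> real (Suc n) powr (1 - q) / (1 - q) - real n powr (1 - q) / (1 - q)"
    using assms by (simp add: pos_le_divide_eq mult.commute flip: diff_divide_distrib)
  then show ?case using Suc by simp
qed simp

text \<open>The limit bounds \<open>b k\<close> by a multiple of \<open>k powr (- q)\<close> for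
  \<open>k > 0\<close>. The term \<open>k = 0\<close> is split off because
  \<open>0 powr (- q) = 0\<close>, and is absorbed using
  \<open>1 \<le> N powr (1 - q)\<close>.\<close>

lemma sum_tail_le:
  fixes b :: "nat \<Rightarrow> real"
  assumes "0 < q" "q < 1" and nonneg: "\<And>k. 0 \<le> b k" and lim: "(\<lambda>N. real N powr q * b N) \<longlonglongrightarrow> 0"
  obtains C where "0 \<le> C" and "\<And>N. 0 < N \<Longrightarrow> (\<Sum>k\<le>N. b k) \<le> C * real N powr (1 - q)"
proof -
  from convergent_imp_Bseq[OF convergentI[OF lim]] obtain K
    where K: "0 < K" "\<And>N. norm (real N powr q * b N) \<le> K"
    by (auto elim: BseqE)
  have b: "b k \<le> K * real k powr (- q)" if "0 < k" for k
    using K(2)[of k] nonneg[of k] that by (simp add: powr_minus field_simps)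
  show thesis
  proof (rule that[of "b 0 + K / (1 - q)"])
    fix N :: nat assume N: "0 < N"
    have "(\<Sum>k\<le>N. b k) = b 0 + (\<Sum>k\<in>{1..N}. b k)"
      by (simp add: atMost_atLeast0 sum.atLeast_Suc_atMost)
    also have "\<dots> \<le> b 0 * 1 + K * (\<Sum>k\<in>{1..N}. real k powr (- q))"
      unfolding sum_distrib_left by (intro add_mono sum_mono b) auto
    also have "\<dots> \<le> b 0 * real N powr (1 - q) + K * (real N powr (1 - q) / (1 - q))"
      using N assms K(1) nonneg[of 0]
      by (intro add_mono mult_left_mono sum_powr_le) (auto simp: ge_one_powr_ge_zero)
    finally show "(\<Sum>k\<le>N. b k) \<le> (b 0 + K / (1 - q)) * real N powr (1 - q)"
      by (simp add: algebra_simps)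
  qed (use nonneg[of 0] K(1) assms in auto)
qed

section \<open>Functions that are harmonic off the origin\<close>

text \<open>Pointwise form of the invariance of the ladder chain: for \<open>h, t \<in> {1..N}\<close> both sides equal the sum
  of \<open>r\<close> over \<open>{1 - t..h}\<close>. The last summand allows for a walk that has not yet left the nonpositive
  integers, so that finitely stopped walks can stand in for the ladder heights.\<close>

lemma window_exchange:
  fixes r :: "int \<Rightarrow> real" and h t :: int and N :: nat
  assumes r: "\<And>x. 0 \<le> r x" "\<And>x. r x \<le> 1"
  shows "(\<Sum>k\<le>N. of_bool (int k < t) * r (h - int k)) + (\<Sum>k<N. of_bool (int k < h) * r (int k + 1 - t)) \<le>
    (\<Sum>k\<le>N. of_bool (int k < t) * r (- int k)) + (\<Sum>k<N. of_bool (int k < h) * r (int k + 1)) +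
    (of_bool (int N < h) * (\<Sum>k\<le>N. of_bool (int k < t)) + of_bool (int N < t) * (\<Sum>k<N. of_bool (int k < h)) +
     real (N + 1) * (of_bool (h \<le> 0) + of_bool (t \<le> 0)))"
proof -
  define A1 where "A1 = (\<Sum>k\<le>N. of_bool (int k < t) * r (h - int k))"
  define A2 where "A2 = (\<Sum>k<N. of_bool (int k < h) * r (int k + 1 - t))"
  define A3 where "A3 = (\<Sum>k\<le>N. of_bool (int k < t) * r (- int k))"
  define A4 where "A4 = (\<Sum>k<N. of_bool (int k < h) * r (int k + 1))"
  define S1 where "S1 = (\<Sum>k\<le>N. of_bool (int k < t) :: real)"
  define S2 where "S2 = (\<Sum>k<N. of_bool (int k < h) :: real)"
  note defs = A1_def A2_def A3_def A4_def S1_def S2_def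
  have b: "of_bool P * r x \<le> 1" "of_bool P * r x \<le> of_bool P" "0 \<le> of_bool P * r x" for P x
    using r[of x] by auto
  have S: "A1 \<le> S1" "A2 \<le> S2"
    unfolding defs by (intro sum_mono b)+
  have "A1 \<le> (\<Sum>k\<le>N. 1)" "A2 \<le> (\<Sum>k<N. 1)"
    unfolding defs by (intro sum_mono b)+
  then have N: "A1 \<le> real N + 1" "A2 \<le> real N + 1" by simp_all
  have nonneg: "0 \<le> A3" "0 \<le> A4" "0 \<le> S1" "0 \<le> S2"
    unfolding defs by (intro sum_nonneg; simp add: r)+
  have "A1 + A2 \<le> A3 + A4 +
    (of_bool (int N < h) * S1 + of_bool (int N < t) * S2 +
      (real N + 1) * (of_bool (h \<le> 0) + of_bool (t \<le> 0)))"
    (is "_ \<le> ?rhs")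
  proof -
    \<comment> \<open>If one of the walks has not exited, one left-hand sum is empty and the other
      is at most \<open>N + 1\<close>, which the last summand pays for.\<close>
    consider "h \<le> 0" | "t \<le> 0" | "0 < h" "0 < t" by linarith
    then show ?thesis
    proof cases
      case 1
      then have "A2 = 0" unfolding A2_def by (intro sum.neutral) simp
      then show ?thesis
        using 1 N(1) nonneg by (cases "int N < t"; cases "t \<le> 0") (simp_all add: algebra_simps)
    next
      case 2
      then have "A1 = 0" unfolding A1_def by (intro sum.neutral) simp
      then show ?thesis
        using 2 N(2) nonneg by (cases "int N < h"; cases "h \<le> 0") (simp_all add: algebra_simps)
    next
      case 3
      \<comment> \<open>\<open>t'\<close> is the largest index in the sums cut at \<open>t\<close>,
        while \<open>h'\<close> is the number of indices in those cut at \<open>h\<close>. The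
        ranges of \<open>k\<close> differ because the state \<open>0\<close> belongs to the left
        half of the window.\<close>
      define t' where "t' = min (int N) (t - 1)"
      define h' where "h' = min (int N) h"
      have reindex: "(\<Sum>k\<in>K. of_bool (P k) * r (g k)) = sum r X"
        if "finite K" "bij_betw g {k\<in>K. P k} X" for g :: "nat \<Rightarrow> int" and P K X
      proof -
        have "(\<Sum>k\<in>K. of_bool (P k) * r (g k)) = (\<Sum>k\<in>{k\<in>K. P k}. r (g k))"
          by (rule sum.mono_neutral_cong_right) (use that in auto)
        also have "\<dots> = sum r X"
          by (rule sum.reindex_bij_betw[OF that(2)])
        finally show ?thesis .
      qed
      have A1: "A1 = sum r {h - t'..h}"
        unfolding A1_def
        by (intro reindex bij_betw_byWitness[where f'="\<lambda>x. nat (h - x)"]) (auto simp: t'_def)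
      have A2: "A2 = sum r {1 - t..h' - t}"
        unfolding A2_def
        by (intro reindex bij_betw_byWitness[where f'="\<lambda>x. nat (x + t - 1)"]) (auto simp: h'_def)
      have A3: "A3 = sum r {- t'..0}"
        unfolding A3_def
        by (intro reindex bij_betw_byWitness[where f'="\<lambda>x. nat (- x)"]) (auto simp: t'_def)
      have A4: "A4 = sum r {1..h'}"
        unfolding A4_def
        by (intro reindex bij_betw_byWitness[where f'="\<lambda>x. nat (x - 1)"]) (auto simp: h'_def)
      have "{- t'..0} \<union> {1..h'} = {- t'..h'}" using 3 by (auto simp: t'_def h'_def)
      then have A34: "A3 + A4 = sum r {- t'..h'}"
        unfolding A3 A4 by (subst sum.union_disjoint[symmetric]) auto
      \<comment> \<open>A jump longer than \<open>N\<close> is paid for by its flux term. With one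
        long jump the remaining sum still fits in the window; if both jumps are short, the two
        ranges of \<open>r\<close> tile the window exactly.\<close>
      consider "int N < h" "int N < t" | "int N < h" "t \<le> int N"
        | "h \<le> int N" "int N < t" | "h \<le> int N" "t \<le> int N"
        by linarith
      then show ?thesis
      proof cases
        case 1
        then show ?thesis using S nonneg 3 by simp
      next
        case 2
        have "A2 \<le> sum r {- t'..h'}"
          unfolding A2 using 2 3 r by (intro sum_mono2) (auto simp: t'_def h'_def)
        then show ?thesis using 2 3 S A34 by simp
      next
        case 3
        have "A1 \<le> sum r {- t'..h'}"
          unfolding A1 using 3 \<open>0 < h\<close> r by (intro sum_mono2) (auto simp: t'_def h'_def)
        then show ?thesis using 3 \<open>0 < t\<close> \<open>0 < h\<close> S A34 by simp
      next
        case 4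
        have "{h - t'..h} \<union> {1 - t..h' - t} = {- t'..h'}" using 3 4 by (auto simp: t'_def h'_def)
        then have "A1 + A2 = sum r {- t'..h'}"
          unfolding A1 A2 using 4 3 by (subst sum.union_disjoint[symmetric]) (auto simp: t'_def h'_def)
        then show ?thesis using 3 4 A34 by simp
      qed
    qed
  qed
  then show ?thesis by (simp only: defs of_nat_add of_nat_1)
qed

text \<open>Average \<open>window_exchange\<close> over independent \<open>h\<close> and
  \<open>t\<close>. Harmonicity off the origin cancels all terms except those at the state
  \<open>0\<close>, where one side has the mean of \<open>r\<close> under \<open>H\<close> and the
  other has \<open>r 0 = 0\<close>; the flux bounds this difference.\<close>

lemma harmonic_at_jump_le:
  fixes H T :: "int pmf" and r :: "int \<Rightarrow> real" and N :: nat
  assumes r: "\<And>x. 0 \<le> r x" "\<And>x. r x \<le> 1" and r_0: "r 0 = 0"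
    and left: "\<And>x. x < 0 \<Longrightarrow> measure_pmf.expectation H (\<lambda>h. r (x + h)) = r x"
    and right: "\<And>x. 0 < x \<Longrightarrow> measure_pmf.expectation T (\<lambda>t. r (x - t)) = r x"
  shows "measure_pmf.prob T {0<..} * measure_pmf.expectation H r \<le>
    measure_pmf.prob H {int N<..} * (\<Sum>k\<le>N. measure_pmf.prob T {int k<..}) +
    measure_pmf.prob T {int N<..} * (\<Sum>k<N. measure_pmf.prob H {int k<..}) +
    real (N + 1) * (measure_pmf.prob H {..0} + measure_pmf.prob T {..0})"
proof -
  let ?Q = "pair_pmf H T"
  let ?E = measure_pmf.expectation
  have prob: "?E p (\<lambda>x. of_bool (P x)) = measure_pmf.prob p {x. P x}" for p :: "int pmf" and P
  proof -
    have "(\<lambda>x. of_bool (P x)) = indicat_real {x. P x}" by (auto simp: indicator_def)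
    then show ?thesis by simp
  qed
  \<comment> \<open>\<open>has_bochner_integral\<close> delivers integrability and value of the long
    sums in a single derivation.\<close>
  have hb: "has_bochner_integral (measure_pmf ?Q) (\<lambda>x. f (fst x) * g (snd x)) (?E H f * ?E T g)"
    if "\<And>x. 0 \<le> f x" "\<And>x. f x \<le> 1" "\<And>x. 0 \<le> g x" "\<And>x. g x \<le> 1" for f g :: "int \<Rightarrow> real"
    using expectation_pair_pmf_prod[of f 1 g 1 H T] that
    by (simp add: has_bochner_integral_iff case_prod_beta' integrable_pmf_01 mult_le_one)
  have hb': "has_bochner_integral (measure_pmf ?Q) (\<lambda>x. g (snd x) * f (fst x)) (?E T g * ?E H f)"
    if "\<And>x. 0 \<le> f x" "\<And>x. f x \<le> 1" "\<And>x. 0 \<le> g x" "\<And>x. g x \<le> 1" for f g :: "int \<Rightarrow> real"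
    using hb[of f g] that by (simp add: mult.commute)
  have hb_fst: "has_bochner_integral (measure_pmf ?Q) (\<lambda>x. f (fst x)) (?E H f)"
    if "\<And>x. 0 \<le> f x" "\<And>x. f x \<le> 1" for f :: "int \<Rightarrow> real"
    using hb[of f "\<lambda>_. 1"] that by simp
  have hb_snd: "has_bochner_integral (measure_pmf ?Q) (\<lambda>x. f (snd x)) (?E T f)"
    if "\<And>x. 0 \<le> f x" "\<And>x. f x \<le> 1" for f :: "int \<Rightarrow> real"
    using hb[of "\<lambda>_. 1" f] that by simp
  have lhs: "has_bochner_integral (measure_pmf ?Q)
      (\<lambda>x. (\<Sum>k\<le>N. of_bool (int k < snd x) * r (fst x - int k)) +
        (\<Sum>k<N. of_bool (int k < fst x) * r (int k + 1 - snd x)))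
      ((\<Sum>k\<le>N. ?E T (\<lambda>t. of_bool (int k < t)) * ?E H (\<lambda>h. r (h - int k))) +
        (\<Sum>k<N. ?E H (\<lambda>h. of_bool (int k < h)) * ?E T (\<lambda>t. r (int k + 1 - t))))"
    by (intro has_bochner_integral_add has_bochner_integral_sum hb hb') (simp_all add: r)
  have rhs: "has_bochner_integral (measure_pmf ?Q)
      (\<lambda>x. (\<Sum>k\<le>N. of_bool (int k < snd x) * r (- int k)) +
        (\<Sum>k<N. of_bool (int k < fst x) * r (int k + 1)) +
        ((\<Sum>k\<le>N. of_bool (int N < fst x) * of_bool (int k < snd x)) +
          (\<Sum>k<N. of_bool (int N < snd x) * of_bool (int k < fst x)) +
          real (N + 1) * (of_bool (fst x \<le> 0) + of_bool (snd x \<le> 0))))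
      ((\<Sum>k\<le>N. ?E T (\<lambda>t. of_bool (int k < t)) * r (- int k)) +
        (\<Sum>k<N. ?E H (\<lambda>h. of_bool (int k < h)) * r (int k + 1)) +
        ((\<Sum>k\<le>N. ?E H (\<lambda>h. of_bool (int N < h)) * ?E T (\<lambda>t. of_bool (int k < t))) +
          (\<Sum>k<N. ?E T (\<lambda>t. of_bool (int N < t)) * ?E H (\<lambda>h. of_bool (int k < h))) +
          real (N + 1) * (?E H (\<lambda>h. of_bool (h \<le> 0)) + ?E T (\<lambda>t. of_bool (t \<le> 0)))))"
    by (intro has_bochner_integral_add has_bochner_integral_sum has_bochner_integral_mult_left
        has_bochner_integral_mult_right hb hb' hb_fst hb_snd) (simp_all add: r)
  define A where "A = (\<Sum>k\<in>{0<..N}. measure_pmf.prob T {int k<..} * r (- int k)) +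
    (\<Sum>k<N. measure_pmf.prob H {int k<..} * r (int k + 1))"
  have split_0: "(\<Sum>k\<le>N. g k) = g 0 + (\<Sum>k\<in>{0<..N}. g k)" for g :: "nat \<Rightarrow> real"
  proof -
    have "{..N} = insert 0 {0<..N}" by auto
    then show ?thesis by simp
  qed
  have lhs_eq: "(\<Sum>k\<le>N. measure_pmf.prob T {int k<..} * ?E H (\<lambda>h. r (h - int k))) +
      (\<Sum>k<N. measure_pmf.prob H {int k<..} * ?E T (\<lambda>t. r (int k + 1 - t))) =
      measure_pmf.prob T {0<..} * ?E H r + A"
  proof -
    have "(\<Sum>k\<in>{0<..N}. measure_pmf.prob T {int k<..} * ?E H (\<lambda>h. r (h - int k))) =
        (\<Sum>k\<in>{0<..N}. measure_pmf.prob T {int k<..} * r (- int k))"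
      using left[of "- int k" for k] by (intro sum.cong) auto
    moreover have "?E T (\<lambda>t. r (int k + 1 - t)) = r (int k + 1)" for k :: nat
      by (rule right) simp
    ultimately show ?thesis
      unfolding A_def split_0 by simp
  qed
  have rhs_eq: "(\<Sum>k\<le>N. measure_pmf.prob T {int k<..} * r (- int k)) +
      (\<Sum>k<N. measure_pmf.prob H {int k<..} * r (int k + 1)) = A"
    unfolding A_def split_0 by (simp add: r_0)
  have sets: "{x. a < x} = {a<..}" "{x. x \<le> a} = {..a}" for a :: int by auto
  have "measure_pmf.prob T {0<..} * ?E H r + A \<le> A +
      ((\<Sum>k\<le>N. measure_pmf.prob H {int N<..} * measure_pmf.prob T {int k<..}) +
        (\<Sum>k<N. measure_pmf.prob T {int N<..} * measure_pmf.prob H {int k<..}) +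
        real (N + 1) * (measure_pmf.prob H {..0} + measure_pmf.prob T {..0}))"
  proof -
    have "integral\<^sup>L ?Q (\<lambda>x. (\<Sum>k\<le>N. of_bool (int k < snd x) * r (fst x - int k)) +
        (\<Sum>k<N. of_bool (int k < fst x) * r (int k + 1 - snd x))) \<le>
      integral\<^sup>L ?Q (\<lambda>x. (\<Sum>k\<le>N. of_bool (int k < snd x) * r (- int k)) +
        (\<Sum>k<N. of_bool (int k < fst x) * r (int k + 1)) +
        ((\<Sum>k\<le>N. of_bool (int N < fst x) * of_bool (int k < snd x)) +
          (\<Sum>k<N. of_bool (int N < snd x) * of_bool (int k < fst x)) +
          real (N + 1) * (of_bool (fst x \<le> 0) + of_bool (snd x \<le> 0))))"
    proof (rule integral_mono)
      fix x :: "int \<times> int"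
      show "(\<Sum>k\<le>N. of_bool (int k < snd x) * r (fst x - int k)) +
          (\<Sum>k<N. of_bool (int k < fst x) * r (int k + 1 - snd x)) \<le>
        (\<Sum>k\<le>N. of_bool (int k < snd x) * r (- int k)) +
          (\<Sum>k<N. of_bool (int k < fst x) * r (int k + 1)) +
          ((\<Sum>k\<le>N. of_bool (int N < fst x) * of_bool (int k < snd x)) +
            (\<Sum>k<N. of_bool (int N < snd x) * of_bool (int k < fst x)) +
            real (N + 1) * (of_bool (fst x \<le> 0) + of_bool (snd x \<le> 0)))"
        using window_exchange[OF r, where N=N and h="fst x" and t="snd x"]
        unfolding sum_distrib_left .
    qed (rule integrable.intros[OF lhs] integrable.intros[OF rhs])+
    then show ?thesis
      unfolding has_bochner_integral_integral_eq[OF lhs] has_bochner_integral_integral_eq[OF rhs]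
        prob sets lhs_eq rhs_eq .
  qed
  then show ?thesis by (simp add: sum_distrib_left)
qed

text \<open>A strict ladder height with tail \<open>o(N powr (- p))\<close> and an almost surely
  finite ladder epoch, both phrased through the walk at finite times, so that the ladder height
  itself is never constructed.\<close>

definition light_ladder :: "int pmf \<Rightarrow> real \<Rightarrow> bool" where
  "light_ladder \<mu> p \<longleftrightarrow>
    (\<exists>b. (\<forall>n N. measure_pmf.prob (stopped_walk \<mu> n) {int N<..} \<le> b N) \<and>
      (\<lambda>N. real N powr p * b N) \<longlonglongrightarrow> 0) \<and>
    (\<lambda>n. measure_pmf.prob (stopped_walk \<mu> n) {..0}) \<longlonglongrightarrow> 0"

section \<open>From moment conditions to light ladders\<close>

lemma light_ladder_drift:
  fixes \<mu> :: "int pmf"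
  assumes "(\<integral>\<^sup>+z. neg_part (real_of_int z) \<partial>\<mu>) < (\<integral>\<^sup>+z. pos_part (real_of_int z) \<partial>\<mu>)"
    and "(\<integral>\<^sup>+z. pos_part (real_of_int z) powr p \<partial>\<mu>) < \<infinity>" and "0 < p"
  shows "light_ladder \<mu> p"
  using stopped_walk_tail_drift[OF assms] exit_time_finite_drift[OF assms(1)]
  unfolding light_ladder_def by metis

text \<open>The moment makes the two equal means finite, so the law is integrable and centered.
  Excluding the point mass at \<open>0\<close> then forces negative steps to have positive
  probability, which the Green function bound and the exit argument both use.\<close>

lemma light_ladder_centered:
  fixes \<mu> :: "int pmf"
  assumes mean: "(\<integral>\<^sup>+z. neg_part (real_of_int z) \<partial>\<mu>) = (\<integral>\<^sup>+z. pos_part (real_of_int z) \<partial>\<mu>)"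
    and moment: "(\<integral>\<^sup>+z. pos_part (real_of_int z) powr (1 + p) \<partial>\<mu>) < \<infinity>" and "0 < p"
    and "set_pmf \<mu> \<noteq> {0}"
  shows "light_ladder \<mu> p"
proof -
  \<comment> \<open>This rests on integrality: a positive \<open>z\<close> is at least
    \<open>1\<close>.\<close>
  have "pos_part (real_of_int z) \<le> pos_part (real_of_int z) powr (1 + p)" for z
  proof (cases "0 < z")
    case True
    then have "real_of_int z powr 1 \<le> real_of_int z powr (1 + p)"
      using \<open>0 < p\<close> by (intro powr_mono) auto
    then show ?thesis using True by (simp add: pos_part_def)
  qed (simp add: pos_part_def)
  then have "(\<integral>\<^sup>+z. pos_part (real_of_int z) \<partial>\<mu>) \<le> (\<integral>\<^sup>+z. pos_part (real_of_int z) powr (1 + p) \<partial>\<mu>)"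
    by (intro nn_integral_mono ennreal_leI)
  then have fin: "(\<integral>\<^sup>+z. pos_part (real_of_int z) \<partial>\<mu>) < \<infinity>"
    using moment by (rule le_less_trans)
  have nonneg: "0 \<le> pos_part x" "0 \<le> neg_part x" for x
    by (auto simp: pos_part_def neg_part_def)
  have int: "integrable (measure_pmf \<mu>) (\<lambda>z. pos_part (real_of_int z))"
      "integrable (measure_pmf \<mu>) (\<lambda>z. neg_part (real_of_int z))"
    using fin mean nonneg by (auto intro!: integrableI_nonneg)
  have eq: "(\<integral>z. neg_part (real_of_int z) \<partial>\<mu>) = (\<integral>z. pos_part (real_of_int z) \<partial>\<mu>)"
    using mean int nonneg by (simp add: nn_integral_eq_integral)
  have split: "real_of_int = (\<lambda>z. pos_part (real_of_int z) - neg_part (real_of_int z))"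
    by (auto simp: pos_part_def neg_part_def)
  have int_id: "integrable (measure_pmf \<mu>) real_of_int"
    by (subst split) (rule Bochner_Integration.integrable_diff[OF int])
  have mean_0: "(\<integral>z. real_of_int z \<partial>\<mu>) = 0"
    using Bochner_Integration.integral_diff[OF int] eq split by simp
  have neg: "0 < measure_pmf.prob \<mu> {..<0}"
  proof (rule ccontr)
    assume "\<not> 0 < measure_pmf.prob \<mu> {..<0}"
    then have "measure_pmf.prob \<mu> {..<0} = 0"
      by (simp add: order.antisym)
    then have ge: "0 \<le> z" if "z \<in> set_pmf \<mu>" for z
      using that by (force simp: measure_pmf_zero_iff)
    then have "AE z in \<mu>. neg_part (real_of_int z) = 0"
      by (auto simp: AE_measure_pmf_iff neg_part_def)
    then have "(\<integral>z. pos_part (real_of_int z) \<partial>\<mu>) = 0"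
      using integral_cong_AE[of "\<lambda>z. neg_part (real_of_int z)" "measure_pmf \<mu>" "\<lambda>_. 0"] eq by simp
    then have "AE z in \<mu>. pos_part (real_of_int z) = 0"
      using integral_nonneg_eq_0_iff_AE[OF int(1)] nonneg by simp
    then have "z \<le> 0" if "z \<in> set_pmf \<mu>" for z
      using that by (auto simp: AE_measure_pmf_iff pos_part_def max_def split: if_splits)
    with ge have "set_pmf \<mu> \<subseteq> {0}" by force
    then show False
      using \<open>set_pmf \<mu> \<noteq> {0}\<close> set_pmf_not_empty[of \<mu>] by blast
  qed
  show ?thesis
    using stopped_walk_tail_centered[OF neg moment \<open>0 < p\<close>] exit_time_finite_centered[OF int_id mean_0 neg]
    unfolding light_ladder_def by metis
qed

section \<open>Harmonic functions along the stopped walk\<close>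

lemma expectation_stopped_walk_harmonic:
  fixes r :: "int \<Rightarrow> real"
  assumes r: "\<And>x. 0 \<le> r x" "\<And>x. r x \<le> 1"
    and harmonic: "\<And>x. x < 0 \<Longrightarrow> measure_pmf.expectation \<mu> (\<lambda>z. r (x + z)) = r x"
    and "x < 0"
  shows "measure_pmf.expectation (stopped_walk \<mu> n) (\<lambda>h. r (x + h)) = r x"
proof (induction n)
  case 0
  show ?case by simp
next
  case (Suc n)
  \<comment> \<open>An unfrozen \<open>y\<close> is at most \<open>0\<close>, so
    \<open>x + y < 0\<close> lies where \<open>r\<close> is harmonic; the origin is out of reach
    before freezing.\<close>
  have "measure_pmf.expectation (exit_step \<mu> y) (\<lambda>h. r (x + h)) = r (x + y)" for y
    using harmonic[of "x + y"] \<open>x < 0\<close> by (simp add: expectation_exit_step add.assoc)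
  then show ?case
    using Suc r by (simp add: expectation_bind_pmf_bounded[where B=1])
qed

text \<open>The walk from \<open>0\<close> may revisit \<open>0\<close> before freezing, and
  \<open>r\<close> need not be harmonic there. As \<open>r 0 = 0\<close> is minimal,
  \<open>r\<close> along the walk is still a submartingale. Time \<open>1\<close> is the start,
  where the walk has law \<open>\<mu>\<close>.\<close>

lemma expectation_le_stopped_walk:
  fixes r :: "int \<Rightarrow> real"
  assumes r: "\<And>x. 0 \<le> r x" "\<And>x. r x \<le> 1" and r_0: "r 0 = 0"
    and harmonic: "\<And>x. x < 0 \<Longrightarrow> measure_pmf.expectation \<mu> (\<lambda>z. r (x + z)) = r x"
  shows "measure_pmf.expectation \<mu> r \<le> measure_pmf.expectation (stopped_walk \<mu> (Suc n)) r"
proof (induction n)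
  case 0
  show ?case
    by (simp add: bind_return_pmf expectation_exit_step)
next
  case (Suc n)
  have step: "r y \<le> measure_pmf.expectation (exit_step \<mu> y) r" for y
  proof (cases y "0 :: int" rule: linorder_cases)
    case equal
    then show ?thesis using r_0 expectation_pmf_01(1)[OF r] by (simp add: expectation_exit_step)
  qed (simp_all add: expectation_exit_step harmonic)
  have "measure_pmf.expectation (stopped_walk \<mu> (Suc n)) r \<le>
      measure_pmf.expectation (stopped_walk \<mu> (Suc n)) (\<lambda>y. measure_pmf.expectation (exit_step \<mu> y) r)"
    by (intro integral_mono integrable_pmf_01 expectation_pmf_01 r step)
  also have "\<dots> = measure_pmf.expectation (stopped_walk \<mu> (Suc (Suc n))) r"
    unfolding stopped_walk.simps(2)[of \<mu> "Suc n"] by (rule expectation_bind_pmf_bounded[OF r, symmetric])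
  finally show ?case using Suc by linarith
qed

text \<open>\<open>\<nu>\<close> is the reflected step law of the right half-line. The limit is
  taken first in the time \<open>n\<close>, which removes the unfinished walks despite the factor
  \<open>N + 1\<close>, and then in the window size \<open>N\<close>.\<close>

lemma expectation_harmonic_eq_0:
  fixes r :: "int \<Rightarrow> real" and \<mu> \<nu> :: "int pmf"
  assumes light: "light_ladder \<mu> p" "light_ladder \<nu> q"
    and pq: "0 < p" "p < 1" "0 < q" "q < 1" "p + q = 1"
    and r: "\<And>x. 0 \<le> r x" "\<And>x. r x \<le> 1" and r_0: "r 0 = 0"
    and left: "\<And>x. x < 0 \<Longrightarrow> measure_pmf.expectation \<mu> (\<lambda>z. r (x + z)) = r x"
    and right: "\<And>x. 0 < x \<Longrightarrow> measure_pmf.expectation \<nu> (\<lambda>z. r (x - z)) = r x"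
  shows "measure_pmf.expectation \<mu> r = 0"
proof -
  define H where "H n = stopped_walk \<mu> (Suc n)" for n
  define T where "T n = stopped_walk \<nu> (Suc n)" for n
  obtain b where b: "\<And>n N. measure_pmf.prob (stopped_walk \<mu> n) {int N<..} \<le> b N"
      "(\<lambda>N. real N powr p * b N) \<longlonglongrightarrow> 0"
    using light(1) unfolding light_ladder_def by blast
  obtain c where c: "\<And>n N. measure_pmf.prob (stopped_walk \<nu> n) {int N<..} \<le> c N"
      "(\<lambda>N. real N powr q * c N) \<longlonglongrightarrow> 0"
    using light(2) unfolding light_ladder_def by blast
  have tails: "measure_pmf.prob (H n) {int N<..} \<le> b N" "measure_pmf.prob (T n) {int N<..} \<le> c N" for n N
    unfolding H_def T_def by (rule b c)+
  have nonneg: "0 \<le> b N" "0 \<le> c N" for N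
    using order_trans[OF measure_nonneg b(1)] order_trans[OF measure_nonneg c(1)] by auto
  have lim: "(\<lambda>n. measure_pmf.prob (H n) {..0}) \<longlonglongrightarrow> 0" "(\<lambda>n. measure_pmf.prob (T n) {..0}) \<longlonglongrightarrow> 0"
    using light[unfolded light_ladder_def, THEN conjunct2, THEN LIMSEQ_Suc] unfolding H_def T_def .
  have H_harmonic: "measure_pmf.expectation (H n) (\<lambda>h. r (x + h)) = r x" if "x < 0" for n x
    unfolding H_def by (rule expectation_stopped_walk_harmonic[OF r left that])
  \<comment> \<open>Mirror image of the left half-line, applied to
    \<open>\<lambda>x. r (- x)\<close> at the point \<open>- x\<close>.\<close>
  have T_harmonic: "measure_pmf.expectation (T n) (\<lambda>t. r (x - t)) = r x" if "0 < x" for n x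
    using expectation_stopped_walk_harmonic[of "\<lambda>x. r (- x)" \<nu> "- x" "Suc n"] right that r
    unfolding T_def by simp
  \<comment> \<open>The flux with each tail replaced by its bound uniform in
    \<open>n\<close>.\<close>
  define e where "e N = b N * (\<Sum>k\<le>N. c k) + c N * (\<Sum>k\<le>N. b k)" for N
  have "measure_pmf.expectation \<mu> r \<le> e N" for N
  proof -
    have "measure_pmf.expectation \<mu> r \<le> e N +
        (real (N + 1) * (measure_pmf.prob (H n) {..0} + measure_pmf.prob (T n) {..0}) +
         measure_pmf.prob (T n) {..0})" for n
    proof -
      let ?c = "measure_pmf.expectation (H n) r"
      have c_01: "0 \<le> ?c" "?c \<le> 1" using expectation_pmf_01[of r] r by auto
      have compl: "measure_pmf.prob (T n) {0<..} = 1 - measure_pmf.prob (T n) {..0}"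
        using measure_pmf.prob_compl[of "{..0}" "T n"] by (simp add: Compl_eq_Diff_UNIV[symmetric])
      have "measure_pmf.expectation \<mu> r \<le> ?c"
        unfolding H_def by (rule expectation_le_stopped_walk[OF r r_0 left])
      \<comment> \<open>Since \<open>?c \<le> 1\<close>, the factor needed by
        \<open>harmonic_at_jump_le\<close> is inserted at a cost that vanishes as \<open>n\<close>
        grows.\<close>
      also have "\<dots> \<le> measure_pmf.prob (T n) {0<..} * ?c + measure_pmf.prob (T n) {..0}"
        unfolding compl using c_01 mult_left_le[OF c_01(2), of "measure_pmf.prob (T n) {..0}"]
        by (simp add: algebra_simps)
      also have "\<dots> \<le> (measure_pmf.prob (H n) {int N<..} * (\<Sum>k\<le>N. measure_pmf.prob (T n) {int k<..}) +
          measure_pmf.prob (T n) {int N<..} * (\<Sum>k<N. measure_pmf.prob (H n) {int k<..}) +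
          real (N + 1) * (measure_pmf.prob (H n) {..0} + measure_pmf.prob (T n) {..0})) +
          measure_pmf.prob (T n) {..0}"
        by (intro add_right_mono harmonic_at_jump_le r r_0 H_harmonic T_harmonic)
      also have "\<dots> \<le> (b N * (\<Sum>k\<le>N. c k) + c N * (\<Sum>k\<le>N. b k) +
          real (N + 1) * (measure_pmf.prob (H n) {..0} + measure_pmf.prob (T n) {..0})) +
          measure_pmf.prob (T n) {..0}"
      proof (intro add_right_mono add_mono mult_mono tails nonneg sum_mono sum_nonneg measure_nonneg)
        have "(\<Sum>k<N. measure_pmf.prob (H n) {int k<..}) \<le> (\<Sum>k<N. b k)"
          by (intro sum_mono tails)
        also have "\<dots> \<le> (\<Sum>k\<le>N. b k)"
          by (intro sum_mono2) (auto simp: nonneg)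
        finally show "(\<Sum>k<N. measure_pmf.prob (H n) {int k<..}) \<le> (\<Sum>k\<le>N. b k)" .
      qed
      finally show ?thesis by (simp add: e_def)
    qed
    moreover have "(\<lambda>n. e N + (real (N + 1) * (measure_pmf.prob (H n) {..0} + measure_pmf.prob (T n) {..0}) +
         measure_pmf.prob (T n) {..0})) \<longlonglongrightarrow> e N + (real (N + 1) * (0 + 0) + 0)"
      by (intro tendsto_intros lim)
    ultimately show ?thesis
      by (intro LIMSEQ_le_const[where x="e N"]) auto
  qed
  moreover have "e \<longlonglongrightarrow> 0"
  proof -
    obtain B where B: "0 \<le> B" "\<And>N. 0 < N \<Longrightarrow> (\<Sum>k\<le>N. b k) \<le> B * real N powr (1 - p)"
      using sum_tail_le[OF pq(1,2) nonneg(1) b(2)] by blast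
    obtain C where C: "0 \<le> C" "\<And>N. 0 < N \<Longrightarrow> (\<Sum>k\<le>N. c k) \<le> C * real N powr (1 - q)"
      using sum_tail_le[OF pq(3,4) nonneg(2) c(2)] by blast
    \<comment> \<open>The partial sums of \<open>c\<close> grow at most like
      \<open>N powr (1 - q) = N powr p\<close>, which \<open>b N\<close> beats; likewise with the
      roles exchanged. This is where \<open>p + q = 1\<close> enters.\<close>
    have "(\<lambda>N. C * (real N powr p * b N) + B * (real N powr q * c N)) \<longlonglongrightarrow> C * 0 + B * 0"
      by (intro tendsto_intros b c)
    then have "(\<lambda>N. C * (real N powr p * b N) + B * (real N powr q * c N)) \<longlonglongrightarrow> 0"
      by simp
    moreover have "eventually (\<lambda>N. norm (e N) \<le> C * (real N powr p * b N) + B * (real N powr q * c N)) sequentially"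
      using eventually_gt_at_top[of 0]
    proof eventually_elim
      case (elim N)
      have pq': "1 - q = p" "1 - p = q" using pq by simp_all
      have "b N * (\<Sum>k\<le>N. c k) \<le> b N * (C * real N powr p)"
        using C(2)[OF elim] unfolding pq' by (intro mult_left_mono nonneg)
      moreover have "c N * (\<Sum>k\<le>N. b k) \<le> c N * (B * real N powr q)"
        using B(2)[OF elim] unfolding pq' by (intro mult_left_mono nonneg)
      moreover have "0 \<le> e N"
        unfolding e_def by (intro add_nonneg_nonneg mult_nonneg_nonneg sum_nonneg nonneg)
      ultimately show ?case
        by (simp add: e_def ac_simps)
    qed
    ultimately show ?thesis by (rule Lim_null_comparison[rotated])
  qed
  ultimately have "measure_pmf.expectation \<mu> r \<le> 0"
    by (intro LIMSEQ_le_const[where X=e]) auto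
  then show ?thesis using expectation_pmf_01(1)[OF r, of \<mu>] by (rule order.antisym)
qed

section \<open>The oscillating process\<close>

text \<open>With \<open>0\<close> absorbing, never having hit \<open>0\<close> is the same as being
  nonzero now.\<close>

definition oscillating_step :: "int pmf \<Rightarrow> int pmf \<Rightarrow> int \<Rightarrow> int pmf" where
  "oscillating_step \<mu> \<mu>' x =
    (if x < 0 then map_pmf ((+) x) \<mu> else if 0 < x then map_pmf ((+) x) \<mu>' else return_pmf 0)"

primrec avoidance :: "int pmf \<Rightarrow> int pmf \<Rightarrow> nat \<Rightarrow> int \<Rightarrow> real" where
  "avoidance \<mu> \<mu>' 0 x = of_bool (x \<noteq> 0)"
| "avoidance \<mu> \<mu>' (Suc n) x = measure_pmf.expectation (oscillating_step \<mu> \<mu>' x) (avoidance \<mu> \<mu>' n)"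

lemma avoidance_01: "0 \<le> avoidance \<mu> \<mu>' n x" "avoidance \<mu> \<mu>' n x \<le> 1"
proof -
  have "0 \<le> avoidance \<mu> \<mu>' n x \<and> avoidance \<mu> \<mu>' n x \<le> 1"
  proof (induction n arbitrary: x)
    case (Suc n)
    then show ?case using expectation_pmf_01[of "avoidance \<mu> \<mu>' n"] by simp
  qed auto
  then show "0 \<le> avoidance \<mu> \<mu>' n x" "avoidance \<mu> \<mu>' n x \<le> 1" by auto
qed

lemma avoidance_0: "avoidance \<mu> \<mu>' n 0 = 0"
  by (induction n) (auto simp: oscillating_step_def)

lemma avoidance_decseq: "decseq (\<lambda>n. avoidance \<mu> \<mu>' n x)"
proof (rule decseq_SucI)
  show "avoidance \<mu> \<mu>' (Suc n) x \<le> avoidance \<mu> \<mu>' n x" for n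
  proof (induction n arbitrary: x)
    case 0
    have "avoidance \<mu> \<mu>' (Suc 0) x \<le> 1" by (rule avoidance_01)
    then show ?case
      using avoidance_0[of \<mu> \<mu>' "Suc 0"] by (cases "x = 0") (auto simp del: avoidance.simps(2))
  next
    case (Suc n)
    show ?case
      by (subst (1 2) avoidance.simps(2), intro integral_mono integrable_pmf_01 Suc)
        (rule avoidance_01)+
  qed
qed

text \<open>The avoidance probabilities decrease to a limit \<open>r\<close> that is harmonic for
  the absorbed chain and vanishes at \<open>0\<close>; dominated convergence reduces both claims to
  the mean of \<open>r\<close> after one step.\<close>

lemma expectation_avoidance_tendsto_0:
  fixes \<mu> \<mu>' :: "int pmf"
  assumes light: "light_ladder \<mu> p" "light_ladder (map_pmf uminus \<mu>') q"
    and pq: "0 < p" "p < 1" "0 < q" "q < 1" "p + q = 1"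
  shows "(\<lambda>n. measure_pmf.expectation \<mu> (avoidance \<mu> \<mu>' n)) \<longlonglongrightarrow> 0"
    and "(\<lambda>n. measure_pmf.expectation \<mu>' (avoidance \<mu> \<mu>' n)) \<longlonglongrightarrow> 0"
proof -
  have "\<exists>l. (\<lambda>n. avoidance \<mu> \<mu>' n x) \<longlonglongrightarrow> l" for x
    using decseq_convergent[OF avoidance_decseq, of 0 \<mu> \<mu>' x] avoidance_01(1) by metis
  then obtain r where r: "\<And>x. (\<lambda>n. avoidance \<mu> \<mu>' n x) \<longlonglongrightarrow> r x"
    by metis
  have r_01: "0 \<le> r x" "r x \<le> 1" for x
    using r[of x] by (auto intro: LIMSEQ_le_const LIMSEQ_le_const2 simp: avoidance_01)
  have r_0: "r 0 = 0"
    using r[of 0] by (simp add: avoidance_0 LIMSEQ_const_iff)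
  have conv: "(\<lambda>n. measure_pmf.expectation L (avoidance \<mu> \<mu>' n)) \<longlonglongrightarrow> measure_pmf.expectation L r" for L
    by (rule integral_dominated_convergence[where w="\<lambda>_. 1"]) (auto simp: r avoidance_01)
  have harmonic: "measure_pmf.expectation (oscillating_step \<mu> \<mu>' x) r = r x" for x
    using LIMSEQ_unique[OF conv LIMSEQ_Suc[OF r[of x], unfolded avoidance.simps]] .
  have left: "measure_pmf.expectation \<mu> (\<lambda>z. r (x + z)) = r x" if "x < 0" for x
    using harmonic[of x] that by (simp add: oscillating_step_def)
  have right: "measure_pmf.expectation \<mu>' (\<lambda>z. r (x + z)) = r x" if "0 < x" for x
    using harmonic[of x] that by (simp add: oscillating_step_def)
  have "measure_pmf.expectation \<mu> r = 0"
    by (rule expectation_harmonic_eq_0[OF light pq]) (simp_all add: r_01 r_0 left right)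
  then show "(\<lambda>n. measure_pmf.expectation \<mu> (avoidance \<mu> \<mu>' n)) \<longlonglongrightarrow> 0"
    using conv[of \<mu>] by simp
  \<comment> \<open>The second claim is the first one for the chain reflected at the origin, which
    swaps the two laws and the two exponents.\<close>
  have "measure_pmf.expectation (map_pmf uminus \<mu>') (\<lambda>x. r (- x)) = 0"
  proof (rule expectation_harmonic_eq_0[OF light(2,1) pq(3,4,1,2)])
    show "measure_pmf.expectation (map_pmf uminus \<mu>') (\<lambda>z. r (- (x + z))) = r (- x)" if "x < 0" for x
      using right[of "- x"] that by simp
    show "measure_pmf.expectation \<mu> (\<lambda>z. r (- (x - z))) = r (- x)" if "0 < x" for x
      using left[of "- x"] that by simp
  qed (use pq r_01 r_0 in simp_all)
  then show "(\<lambda>n. measure_pmf.expectation \<mu>' (avoidance \<mu> \<mu>' n)) \<longlonglongrightarrow> 0"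
    using conv[of \<mu>'] by simp
qed

text \<open>Index \<open>n\<close> stands for time \<open>n + 1\<close>: starting after the first step keeps the mixture \<open>\<eta>\<close> out of
  the recursion.\<close>

primrec absorbed_chain :: "nat \<Rightarrow> (nat \<Rightarrow> int \<times> int \<times> int) \<Rightarrow> int" where
  "absorbed_chain 0 s = snd (snd (s 1))"
| "absorbed_chain (Suc n) s =
    (let y = absorbed_chain n s in
      y + fst (s (n + 2)) * of_bool (y < 0) + fst (snd (s (n + 2))) * of_bool (0 < y))"

text \<open>Only coordinates \<open>1\<close> to \<open>n + 1\<close> are read, which makes the
  state independent of the triple with index \<open>n + 2\<close>.\<close>

lemma absorbed_chain_restrict:
  "n < m \<Longrightarrow> absorbed_chain n (restrict s {1..m}) = absorbed_chain n s"
  by (induction n) auto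

lemma absorbed_chain_measurable:
  "n < m \<Longrightarrow> absorbed_chain n \<in> PiM {1..m} (\<lambda>_. count_space UNIV) \<rightarrow>\<^sub>M count_space UNIV"
proof (induction n)
  case 0
  have "(\<lambda>s. s 1) \<in> PiM {1..m} (\<lambda>_. count_space (UNIV :: (int \<times> int \<times> int) set)) \<rightarrow>\<^sub>M count_space UNIV"
    using 0 by (intro measurable_component_singleton) auto
  from measurable_compose[OF this, of "\<lambda>t. snd (snd t)" "count_space UNIV"] show ?case
    by simp
next
  case (Suc n)
  have comp: "(\<lambda>s. s (n + 2)) \<in> PiM {1..m} (\<lambda>_. count_space (UNIV :: (int \<times> int \<times> int) set)) \<rightarrow>\<^sub>M count_space UNIV"
    using Suc by (intro measurable_component_singleton) auto
  \<comment> \<open>For a fixed state the update depends measurably on one coordinate; countability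
    of the states then lets the state vary.\<close>
  have "(\<lambda>s. y + fst (s (n + 2)) * of_bool (y < 0) + fst (snd (s (n + 2))) * of_bool (0 < y))
      \<in> PiM {1..m} (\<lambda>_. count_space (UNIV :: (int \<times> int \<times> int) set)) \<rightarrow>\<^sub>M count_space UNIV" for y :: int
    by (rule measurable_compose[OF comp]) simp
  then show ?case
    unfolding absorbed_chain.simps Let_def
    by (rule measurable_compose_countable) (use Suc in auto)
qed

text \<open>The two chains can differ only after a visit to \<open>0\<close>, so they agree on the
  paths that never return, the event to be shown null.\<close>

lemma absorbed_chain_eq_process:
  assumes "\<And>k. 1 \<le> k \<Longrightarrow> oscillating_process \<xi> \<xi>' \<eta> 0 k \<omega> \<noteq> 0"
  shows "absorbed_chain n (\<lambda>i. (\<xi> i \<omega>, \<xi>' i \<omega>, \<eta> i \<omega>)) = oscillating_process \<xi> \<xi>' \<eta> 0 (Suc n) \<omega>"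
proof (induction n)
  case 0
  show ?case by simp
next
  case (Suc n)
  have "oscillating_process \<xi> \<xi>' \<eta> 0 (Suc (Suc n)) \<omega> =
      (let y = oscillating_process \<xi> \<xi>' \<eta> 0 (Suc n) \<omega> in
        y + \<xi> (n + 2) \<omega> * of_bool (y \<le> - 1) + \<eta> (n + 2) \<omega> * of_bool (y = 0) + \<xi>' (n + 2) \<omega> * of_bool (y \<ge> 1))"
    by (subst oscillating_process.simps) simp
  moreover have "oscillating_process \<xi> \<xi>' \<eta> 0 (Suc n) \<omega> \<noteq> 0"
    by (rule assms) simp
  ultimately show ?case
    unfolding absorbed_chain.simps Suc Let_def
    by (cases "oscillating_process \<xi> \<xi>' \<eta> 0 (Suc n) \<omega>" rule: linorder_cases[where y=0])
      (auto simp del: oscillating_process.simps)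
qed

section \<open>The chain on the underlying probability space\<close>

context oscillating_increments
begin

lemma increments_measurable:
  assumes "1 \<le> n"
  shows "(\<lambda>\<omega>. (\<xi> n \<omega>, \<xi>' n \<omega>, \<eta> n \<omega>)) \<in> M \<rightarrow>\<^sub>M count_space UNIV"
    and "\<xi> n \<in> M \<rightarrow>\<^sub>M count_space UNIV" and "\<xi>' n \<in> M \<rightarrow>\<^sub>M count_space UNIV"
    and "\<eta> n \<in> M \<rightarrow>\<^sub>M count_space UNIV"
proof -
  show *: "(\<lambda>\<omega>. (\<xi> n \<omega>, \<xi>' n \<omega>, \<eta> n \<omega>)) \<in> M \<rightarrow>\<^sub>M count_space UNIV"
    using indep assms by (auto simp: indep_vars_def)
  show "\<xi> n \<in> M \<rightarrow>\<^sub>M count_space UNIV" "\<xi>' n \<in> M \<rightarrow>\<^sub>M count_space UNIV" "\<eta> n \<in> M \<rightarrow>\<^sub>M count_space UNIV"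
    using measurable_compose[OF *, of fst "count_space UNIV"]
      measurable_compose[OF *, of "\<lambda>t. fst (snd t)" "count_space UNIV"]
      measurable_compose[OF *, of "\<lambda>t. snd (snd t)" "count_space UNIV"] by auto
qed

abbreviation absorbed :: "nat \<Rightarrow> 'w \<Rightarrow> int" where
  "absorbed n \<omega> \<equiv> absorbed_chain n (\<lambda>i. (\<xi> i \<omega>, \<xi>' i \<omega>, \<eta> i \<omega>))"

text \<open>The constant \<open>0\<close> entries only serve to give both variables the same type, as
  \<^const>\<open>indep_var\<close> demands.\<close>

lemma absorbed_indep:
  "indep_var (count_space UNIV) (\<lambda>\<omega>. (absorbed n \<omega>, 0, 0))
    (count_space UNIV) (\<lambda>\<omega>. (\<xi> (n + 2) \<omega>, \<xi>' (n + 2) \<omega>, \<eta> (n + 2) \<omega>))"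
proof -
  let ?Y = "\<lambda>i \<omega>. (\<xi> i \<omega>, \<xi>' i \<omega>, \<eta> i \<omega>)"
  have "indep_var (PiM {1..n + 1} (\<lambda>_. count_space UNIV)) (\<lambda>\<omega>. restrict (\<lambda>i. ?Y i \<omega>) {1..n + 1})
      (PiM {n + 2} (\<lambda>_. count_space UNIV)) (\<lambda>\<omega>. restrict (\<lambda>i. ?Y i \<omega>) {n + 2})"
    by (rule indep_var_restrict[OF indep]) auto
  moreover have "(\<lambda>s. (absorbed_chain n s, 0, 0)) \<in>
      PiM {1..n + 1} (\<lambda>_. count_space UNIV) \<rightarrow>\<^sub>M count_space (UNIV :: (int \<times> int \<times> int) set)"
    by (rule measurable_compose[OF absorbed_chain_measurable]) auto
  moreover have "(\<lambda>s. s (n + 2)) \<in>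
      PiM {n + 2} (\<lambda>_. count_space UNIV) \<rightarrow>\<^sub>M count_space (UNIV :: (int \<times> int \<times> int) set)"
    by (rule measurable_component_singleton) simp
  ultimately have "indep_var (count_space UNIV)
      ((\<lambda>s. (absorbed_chain n s, 0, 0)) \<circ> (\<lambda>\<omega>. restrict (\<lambda>i. ?Y i \<omega>) {1..n + 1}))
      (count_space UNIV) ((\<lambda>s. s (n + 2)) \<circ> (\<lambda>\<omega>. restrict (\<lambda>i. ?Y i \<omega>) {n + 2}))"
    by (rule indep_var_compose)
  moreover have "absorbed_chain n (restrict s {1..n + 1}) = absorbed_chain n s" for s
    by (rule absorbed_chain_restrict) simp
  ultimately show ?thesis
    by (simp only: comp_def) simp
qed

lemma absorbed_measurable: "absorbed n \<in> M \<rightarrow>\<^sub>M count_space UNIV"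
  using measurable_compose[OF indep_var_rv1[OF absorbed_indep[of n]], of fst "count_space UNIV"] by simp

text \<open>Markov property: by independence the state and the next triple have a product joint law,
  so the triple is integrated out with the state held fixed.\<close>

lemma absorbed_Suc_nn_integral:
  fixes f :: "int \<Rightarrow> ennreal"
  shows "(\<integral>\<^sup>+\<omega>. f (absorbed (Suc n) \<omega>) \<partial>M) =
    (\<integral>\<^sup>+\<omega>. (\<integral>\<^sup>+y. f y \<partial>oscillating_step \<mu> \<mu>' (absorbed n \<omega>)) \<partial>M)"
proof -
  let ?V = "\<lambda>\<omega>. (\<xi> (n + 2) \<omega>, \<xi>' (n + 2) \<omega>, \<eta> (n + 2) \<omega>)"
  let ?Z = "\<lambda>\<omega>. (absorbed n \<omega>, 0 :: int, 0 :: int)"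
  let ?C = "count_space (UNIV :: int set)" and ?C3 = "count_space (UNIV :: (int \<times> int \<times> int) set)"
  define g where "g y t = y + fst t * of_bool (y < 0) + fst (snd t) * of_bool (0 < y)"
    for y and t :: "int \<times> int \<times> int"
  have V: "?V \<in> M \<rightarrow>\<^sub>M ?C3"
    by (rule increments_measurable) simp
  have Z: "?Z \<in> M \<rightarrow>\<^sub>M ?C3"
    by (rule indep_var_rv1[OF absorbed_indep])
  have CC: "?C3 \<Otimes>\<^sub>M ?C3 = count_space UNIV"
    by (subst pair_measure_countable) simp_all
  have pair: "(\<lambda>\<omega>. (?Z \<omega>, ?V \<omega>)) \<in> M \<rightarrow>\<^sub>M ?C3 \<Otimes>\<^sub>M ?C3"
    using Z V by (intro measurable_Pair) auto
  have law_pair: "distr M ?C3 ?Z \<Otimes>\<^sub>M distr M ?C3 ?V = distr M (?C3 \<Otimes>\<^sub>M ?C3) (\<lambda>\<omega>. (?Z \<omega>, ?V \<omega>))"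
    using absorbed_indep[of n] unfolding indep_var_distribution_eq by simp
  interpret V: prob_space "distr M ?C3 ?V"
    using V by (intro prob_space_distr) auto
  define F where "F x = f (g (fst (fst x)) (snd x))" for x :: "(int \<times> int \<times> int) \<times> (int \<times> int \<times> int)"
  have F: "F \<in> borel_measurable (?C3 \<Otimes>\<^sub>M ?C3)"
    unfolding CC by simp
  have F': "F \<in> borel_measurable (distr M ?C3 ?Z \<Otimes>\<^sub>M distr M ?C3 ?V)"
    unfolding law_pair using F by simp
  have "(\<integral>\<^sup>+\<omega>. f (absorbed (Suc n) \<omega>) \<partial>M) = (\<integral>\<^sup>+\<omega>. F (?Z \<omega>, ?V \<omega>) \<partial>M)"
    by (simp add: F_def g_def Let_def)
  also have "\<dots> = (\<integral>\<^sup>+x. F x \<partial>distr M (?C3 \<Otimes>\<^sub>M ?C3) (\<lambda>\<omega>. (?Z \<omega>, ?V \<omega>)))"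
    by (rule nn_integral_distr[symmetric, OF pair]) (use F in simp)
  also have "\<dots> = (\<integral>\<^sup>+z. \<integral>\<^sup>+t. F (z, t) \<partial>distr M ?C3 ?V \<partial>distr M ?C3 ?Z)"
    unfolding law_pair[symmetric] by (rule V.nn_integral_fst[OF F', symmetric])
  also have "\<dots> = (\<integral>\<^sup>+\<omega>. \<integral>\<^sup>+t. f (g (absorbed n \<omega>) t) \<partial>distr M ?C3 ?V \<partial>M)"
    unfolding F_def by (subst nn_integral_distr[OF Z]) simp_all
  also have "\<dots> = (\<integral>\<^sup>+\<omega>. (\<integral>\<^sup>+y. f y \<partial>oscillating_step \<mu> \<mu>' (absorbed n \<omega>)) \<partial>M)"
  proof (intro nn_integral_cong)
    fix \<omega>
    define y where "y = absorbed n \<omega>"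
    have "(\<integral>\<^sup>+t. f (g y t) \<partial>distr M ?C3 ?V) = (\<integral>\<^sup>+\<omega>. f (g y (?V \<omega>)) \<partial>M)"
      by (rule nn_integral_distr[OF V]) simp
    \<comment> \<open>On each side of the origin a single component of the triple is read, so its
      marginal law determines the inner integral.\<close>
    also have "\<dots> = (\<integral>\<^sup>+y. f y \<partial>oscillating_step \<mu> \<mu>' y)"
    proof (cases y "0 :: int" rule: linorder_cases)
      case less
      have "(\<integral>\<^sup>+\<omega>. f (y + \<xi> (n + 2) \<omega>) \<partial>M) = (\<integral>\<^sup>+z. f (y + z) \<partial>distr M ?C (\<xi> (n + 2)))"
        by (rule nn_integral_distr[symmetric]) (use increments_measurable(2)[of "n + 2"] in simp_all)
      then show ?thesis using less law_\<xi>[of "n + 2"] by (simp add: g_def oscillating_step_def)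
    next
      case equal
      then show ?thesis by (simp add: g_def oscillating_step_def emeasure_space_1)
    next
      case greater
      have "(\<integral>\<^sup>+\<omega>. f (y + \<xi>' (n + 2) \<omega>) \<partial>M) = (\<integral>\<^sup>+z. f (y + z) \<partial>distr M ?C (\<xi>' (n + 2)))"
        by (rule nn_integral_distr[symmetric]) (use increments_measurable(3)[of "n + 2"] in simp_all)
      then show ?thesis using greater law_\<xi>'[of "n + 2"] by (simp add: g_def oscillating_step_def)
    qed
    finally show "(\<integral>\<^sup>+t. f (g (absorbed n \<omega>) t) \<partial>distr M ?C3 ?V) =
        (\<integral>\<^sup>+y. f y \<partial>oscillating_step \<mu> \<mu>' (absorbed n \<omega>))"
      unfolding y_def .
  qed
  finally show ?thesis .
qed

lemma absorbed_nonzero_sets: "{\<omega> \<in> space M. absorbed n \<omega> \<noteq> 0} \<in> sets M"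
proof -
  have "absorbed n -` (- {0}) \<inter> space M = {\<omega> \<in> space M. absorbed n \<omega> \<noteq> 0}" by auto
  then show ?thesis
    using measurable_sets[OF absorbed_measurable, of "- {0}" n] by simp
qed

lemma prob_absorbed:
  "ennreal (prob {\<omega> \<in> space M. absorbed n \<omega> \<noteq> 0}) = (\<integral>\<^sup>+\<omega>. avoidance \<mu> \<mu>' n (\<eta> 1 \<omega>) \<partial>M)"
proof -
  \<comment> \<open>Each step taken off the chain is added to the horizon \<open>k\<close> of
    \<open>avoidance\<close>, down to the position \<open>\<eta> 1\<close> after the first
    step.\<close>
  have "(\<integral>\<^sup>+\<omega>. avoidance \<mu> \<mu>' k (absorbed m \<omega>) \<partial>M) = (\<integral>\<^sup>+\<omega>. avoidance \<mu> \<mu>' (k + m) (\<eta> 1 \<omega>) \<partial>M)" for k m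
  proof (induction m arbitrary: k)
    case 0
    show ?case by simp
  next
    case (Suc m)
    have "(\<integral>\<^sup>+y. avoidance \<mu> \<mu>' k y \<partial>oscillating_step \<mu> \<mu>' x) = ennreal (avoidance \<mu> \<mu>' (Suc k) x)" for x
      by (simp add: nn_integral_eq_integral integrable_pmf_01 avoidance_01)
    then show ?case
      using absorbed_Suc_nn_integral[of "\<lambda>x. ennreal (avoidance \<mu> \<mu>' k x)" m] Suc[of "Suc k"]
      by (simp del: avoidance.simps absorbed_chain.simps)
  qed
  note this[of 0 n]
  moreover have "(\<integral>\<^sup>+\<omega>. indicator {\<omega> \<in> space M. absorbed n \<omega> \<noteq> 0} \<omega> \<partial>M) =
      (\<integral>\<^sup>+\<omega>. avoidance \<mu> \<mu>' 0 (absorbed n \<omega>) \<partial>M)"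
    by (intro nn_integral_cong) (simp add: indicator_def)
  ultimately show ?thesis
    by (simp add: emeasure_eq_measure absorbed_nonzero_sets)
qed

text \<open>The mixture is realised as a coin toss followed by a draw, so that expectations split
  into those under \<open>\<mu>\<close> and \<open>\<mu>'\<close>.\<close>

lemma law_first_step:
  assumes "0 \<le> \<alpha>" "\<alpha> \<le> 1"
  shows "distr M (count_space UNIV) (\<eta> 1) =
    measure_pmf (bind_pmf (bernoulli_pmf \<alpha>) (\<lambda>b. if b then \<mu> else \<mu>'))"
    (is "?D = measure_pmf ?L")
proof (rule measure_eqI)
  interpret D: prob_space ?D
    using increments_measurable(4)[of 1] by (intro prob_space_distr) simp
  fix A assume "A \<in> sets ?D"
  have "measure_pmf.expectation ?L (indicator A) =
      \<alpha> * measure_pmf.expectation \<mu> (indicator A) + (1 - \<alpha>) * measure_pmf.expectation \<mu>' (indicator A)"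
    using assms by (subst expectation_bind_pmf_bounded[where B=1]) (auto simp: indicator_def mult.commute)
  then show "emeasure ?D A = emeasure ?L A"
    unfolding D.emeasure_eq_measure measure_pmf.emeasure_eq_measure using law_\<eta>[of 1 A] by simp
qed simp

text \<open>The probability of no return up to time \<open>n + 1\<close> is a mixture of two mean
  avoidance probabilities, both tending to \<open>0\<close>. A path that never returns lies in all
  of these events, whose intersection is null.\<close>

lemma recurrent_if_light_ladders:
  assumes \<alpha>: "0 \<le> \<alpha>" "\<alpha> \<le> 1"
    and light: "light_ladder \<mu> p" "light_ladder (map_pmf uminus \<mu>') q"
    and pq: "0 < p" "p < 1" "0 < q" "q < 1" "p + q = 1"
  shows "recurrent_state M (oscillating_process \<xi> \<xi>' \<eta>) 0"
proof -
  let ?S = "\<lambda>n. {\<omega> \<in> space M. absorbed n \<omega> \<noteq> 0}"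
  let ?L = "bind_pmf (bernoulli_pmf \<alpha>) (\<lambda>b. if b then \<mu> else \<mu>')"
  have "prob (?S n) = \<alpha> * measure_pmf.expectation \<mu> (avoidance \<mu> \<mu>' n) +
      (1 - \<alpha>) * measure_pmf.expectation \<mu>' (avoidance \<mu> \<mu>' n)" for n
  proof -
    have "ennreal (prob (?S n)) = (\<integral>\<^sup>+x. avoidance \<mu> \<mu>' n x \<partial>distr M (count_space UNIV) (\<eta> 1))"
      unfolding prob_absorbed
      by (rule nn_integral_distr[symmetric]) (use increments_measurable(4)[of 1] in simp_all)
    also have "\<dots> = ennreal (measure_pmf.expectation ?L (avoidance \<mu> \<mu>' n))"
      unfolding law_first_step[OF \<alpha>]
      by (rule nn_integral_eq_integral) (simp_all add: integrable_pmf_01 avoidance_01)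
    finally have "prob (?S n) = measure_pmf.expectation ?L (avoidance \<mu> \<mu>' n)"
      by (simp add: expectation_pmf_01 avoidance_01)
    also have "\<dots> = \<alpha> * measure_pmf.expectation \<mu> (avoidance \<mu> \<mu>' n) +
        (1 - \<alpha>) * measure_pmf.expectation \<mu>' (avoidance \<mu> \<mu>' n)"
      using \<alpha> by (subst expectation_bind_pmf_bounded[where B=1]) (simp_all add: avoidance_01 mult.commute)
    finally show ?thesis .
  qed
  moreover have "(\<lambda>n. \<alpha> * measure_pmf.expectation \<mu> (avoidance \<mu> \<mu>' n) +
      (1 - \<alpha>) * measure_pmf.expectation \<mu>' (avoidance \<mu> \<mu>' n)) \<longlonglongrightarrow> \<alpha> * 0 + (1 - \<alpha>) * 0"
    by (intro tendsto_intros expectation_avoidance_tendsto_0[OF light pq])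
  ultimately have "(\<lambda>n. prob (?S n)) \<longlonglongrightarrow> 0"
    by simp
  moreover have "prob (\<Inter>n. ?S n) \<le> prob (?S n)" for n
    by (intro finite_measure_mono absorbed_nonzero_sets) auto
  ultimately have "prob (\<Inter>n. ?S n) \<le> 0"
    by (intro LIMSEQ_le_const[where X="\<lambda>n. prob (?S n)"]) auto
  then have "(\<Inter>n. ?S n) \<in> null_sets M"
    using absorbed_nonzero_sets by (intro null_setsI) (auto simp: emeasure_eq_measure measure_le_0_iff)
  then have "AE \<omega> in M. \<omega> \<notin> (\<Inter>n. ?S n)"
    by (rule AE_not_in)
  with AE_space[of M] show ?thesis
    unfolding recurrent_state_def
  proof eventually_elim
    case (elim \<omega>)
    show ?case
    proof (rule ccontr)
      assume "\<not> (\<exists>n\<ge>1. oscillating_process \<xi> \<xi>' \<eta> 0 n \<omega> = 0)"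
      then have nz: "\<And>k. 1 \<le> k \<Longrightarrow> oscillating_process \<xi> \<xi>' \<eta> 0 k \<omega> \<noteq> 0" by blast
      have "absorbed n \<omega> \<noteq> 0" for n
        using nz[of "Suc n"] absorbed_chain_eq_process[OF nz, of n] by (simp del: oscillating_process.simps)
      with elim show False by simp
    qed
  qed
qed

end

section \<open>Transfer of the hypotheses to the two step laws\<close>

theorem corollary4p10:
  fixes M :: "'w measure"
    and \<mu> \<mu>' :: "int pmf"
    and \<xi> \<xi>' \<eta> :: "nat \<Rightarrow> 'w \<Rightarrow> int"
    and \<alpha> p q :: real
  assumes "oscillating_increments M \<alpha> \<mu> \<mu>' \<xi> \<xi>' \<eta>"
    and "Gcd (set_pmf \<mu>) = 1" and "Gcd (set_pmf \<mu>') = 1"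
    and "0 \<le> \<alpha>" and "\<alpha> \<le> 1"
    and "0 < p" and "p < 1" and "0 < q" and "q < 1" and "p + q = 1"
    and "((\<integral>\<^sup>+\<omega>. neg_part (\<xi> 1 \<omega>) \<partial>M) < (\<integral>\<^sup>+\<omega>. pos_part (\<xi> 1 \<omega>) \<partial>M) \<and>
          (\<integral>\<^sup>+\<omega>. pos_part (\<xi> 1 \<omega>) powr p \<partial>M) < \<infinity> \<and>
          (\<integral>\<^sup>+\<omega>. pos_part (\<xi>' 1 \<omega>) \<partial>M) < (\<integral>\<^sup>+\<omega>. neg_part (\<xi>' 1 \<omega>) \<partial>M) \<and>
          (\<integral>\<^sup>+\<omega>. neg_part (\<xi>' 1 \<omega>) powr q \<partial>M) < \<infinity>)
       \<or> ((\<integral>\<^sup>+\<omega>. neg_part (\<xi> 1 \<omega>) \<partial>M) = (\<integral>\<^sup>+\<omega>. pos_part (\<xi> 1 \<omega>) \<partial>M) \<and>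
          (\<integral>\<^sup>+\<omega>. pos_part (\<xi> 1 \<omega>) powr (1 + p) \<partial>M) < \<infinity> \<and>
          (\<integral>\<^sup>+\<omega>. pos_part (\<xi>' 1 \<omega>) \<partial>M) = (\<integral>\<^sup>+\<omega>. neg_part (\<xi>' 1 \<omega>) \<partial>M) \<and>
          (\<integral>\<^sup>+\<omega>. neg_part (\<xi>' 1 \<omega>) powr (1 + q) \<partial>M) < \<infinity>)
       \<or> ((\<integral>\<^sup>+\<omega>. neg_part (\<xi> 1 \<omega>) \<partial>M) < (\<integral>\<^sup>+\<omega>. pos_part (\<xi> 1 \<omega>) \<partial>M) \<and>
          (\<integral>\<^sup>+\<omega>. pos_part (\<xi> 1 \<omega>) powr p \<partial>M) < \<infinity> \<and>
          (\<integral>\<^sup>+\<omega>. pos_part (\<xi>' 1 \<omega>) \<partial>M) = (\<integral>\<^sup>+\<omega>. neg_part (\<xi>' 1 \<omega>) \<partial>M) \<and>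
          (\<integral>\<^sup>+\<omega>. neg_part (\<xi>' 1 \<omega>) powr (1 + q) \<partial>M) < \<infinity>)
       \<or> ((\<integral>\<^sup>+\<omega>. neg_part (\<xi> 1 \<omega>) \<partial>M) = (\<integral>\<^sup>+\<omega>. pos_part (\<xi> 1 \<omega>) \<partial>M) \<and>
          (\<integral>\<^sup>+\<omega>. pos_part (\<xi> 1 \<omega>) powr (1 + p) \<partial>M) < \<infinity> \<and>
          (\<integral>\<^sup>+\<omega>. pos_part (\<xi>' 1 \<omega>) \<partial>M) < (\<integral>\<^sup>+\<omega>. neg_part (\<xi>' 1 \<omega>) \<partial>M) \<and>
          (\<integral>\<^sup>+\<omega>. neg_part (\<xi>' 1 \<omega>) powr q \<partial>M) < \<infinity>)"
  shows "recurrent_state M (oscillating_process \<xi> \<xi>' \<eta>) 0"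
proof -
  interpret oscillating_increments M \<alpha> \<mu> \<mu>' \<xi> \<xi>' \<eta> by fact
  have law: "(\<integral>\<^sup>+\<omega>. ennreal (F (real_of_int (\<xi> 1 \<omega>))) \<partial>M) = (\<integral>\<^sup>+z. ennreal (F (real_of_int z)) \<partial>\<mu>)"
    for F :: "real \<Rightarrow> real"
    unfolding law_\<xi>[of 1, simplified, symmetric]
    by (subst nn_integral_distr) (use increments_measurable(2)[of 1] in simp_all)
  have law': "(\<integral>\<^sup>+\<omega>. ennreal (F (real_of_int (\<xi>' 1 \<omega>))) \<partial>M) = (\<integral>\<^sup>+z. ennreal (F (real_of_int z)) \<partial>\<mu>')"
    for F :: "real \<Rightarrow> real"
    unfolding law_\<xi>'[of 1, simplified, symmetric]
    by (subst nn_integral_distr) (use increments_measurable(3)[of 1] in simp_all)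
  note laws = law[of neg_part] law[of pos_part] law[of "\<lambda>x. pos_part x powr _"]
    law'[of neg_part] law'[of pos_part] law'[of "\<lambda>x. neg_part x powr _"]
  \<comment> \<open>Reflection exchanges the two parts, so the downward ladder on the right
    half-line becomes an upward one.\<close>
  have reflect: "pos_part (- x) = neg_part x" "neg_part (- x) = pos_part x" for x
    unfolding pos_part_def neg_part_def by simp_all
  \<comment> \<open>Since \<open>Gcd {0} = 0\<close>, the gcd conditions exclude the point mass at
    \<open>0\<close>.\<close>
  have nondegenerate: "set_pmf \<mu> \<noteq> {0}" "set_pmf (map_pmf uminus \<mu>') \<noteq> {0}"
  proof -
    show "set_pmf \<mu> \<noteq> {0}"
      using assms(2) by (metis Gcd_0_iff order_refl zero_neq_one)
    have "set_pmf \<mu>' \<noteq> {0}"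
      using assms(3) by (metis Gcd_0_iff order_refl zero_neq_one)
    then obtain z where "z \<in> set_pmf \<mu>'" "z \<noteq> 0"
      using set_pmf_not_empty[of \<mu>'] by blast
    then have "- z \<in> set_pmf (map_pmf uminus \<mu>')" "- z \<noteq> 0" by simp_all
    then show "set_pmf (map_pmf uminus \<mu>') \<noteq> {0}" by blast
  qed
  have drift: "light_ladder (map_pmf uminus \<mu>') q"
    if "(\<integral>\<^sup>+z. pos_part (real_of_int z) \<partial>\<mu>') < (\<integral>\<^sup>+z. neg_part (real_of_int z) \<partial>\<mu>')"
      and "(\<integral>\<^sup>+z. neg_part (real_of_int z) powr q \<partial>\<mu>') < \<infinity>"
    using light_ladder_drift[of "map_pmf uminus \<mu>'" q] that \<open>0 < q\<close>
    unfolding nn_integral_map_pmf of_int_minus reflect by blast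
  have centered: "light_ladder (map_pmf uminus \<mu>') q"
    if "(\<integral>\<^sup>+z. pos_part (real_of_int z) \<partial>\<mu>') = (\<integral>\<^sup>+z. neg_part (real_of_int z) \<partial>\<mu>')"
      and "(\<integral>\<^sup>+z. neg_part (real_of_int z) powr (1 + q) \<partial>\<mu>') < \<infinity>"
    using light_ladder_centered[of "map_pmf uminus \<mu>'" q] that \<open>0 < q\<close> nondegenerate(2)
    unfolding nn_integral_map_pmf of_int_minus reflect by blast
  \<comment> \<open>The four alternatives combine one choice per half-line, drift or centered, so
    the two ladder conditions are proved separately.\<close>
  note hyp = assms(11)[unfolded laws]
  from hyp have "light_ladder \<mu> p"
  proof (elim disjE conjE, goal_cases)
    case 1
    show ?case by (rule light_ladder_drift[OF 1(1,2) \<open>0 < p\<close>])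
  next
    case 2
    show ?case by (rule light_ladder_centered[OF 2(1,2) \<open>0 < p\<close> nondegenerate(1)])
  next
    case 3
    show ?case by (rule light_ladder_drift[OF 3(1,2) \<open>0 < p\<close>])
  next
    case 4
    show ?case by (rule light_ladder_centered[OF 4(1,2) \<open>0 < p\<close> nondegenerate(1)])
  qed
  moreover from hyp have "light_ladder (map_pmf uminus \<mu>') q"
  proof (elim disjE conjE, goal_cases)
    case 1
    show ?case by (rule drift[OF 1(3,4)])
  next
    case 2
    show ?case by (rule centered[OF 2(3,4)])
  next
    case 3
    show ?case by (rule centered[OF 3(3,4)])
  next
    case 4
    show ?case by (rule drift[OF 4(3,4)])
  qed
  ultimately show ?thesis
    using assms by (intro recurrent_if_light_ladders)
qed

end
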